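(* For every $n\ge3$, we have $$\mathbb{E}[L_{0,n}]=\frac{3^{n-1}+2n-7}{8\cdot 3^{n-1}},\qquad \mathbb{E}[L_{1,n}]=\frac{3^{n-1}-n-1}{2\cdot 3^{n-1}},\qquad \mathbb{E}[L_{2,n}]=\frac{3^n+2n+11}{8\cdot 3^{n-1}}.$$
   Context: Let $n\ge3$. Select $n$ i.i.d. points uniformly at random on the unit circle and label them $P_1,\ldots,P_n$ in counterclockwise cyclic order. For $1\le i\le n$ consider the perpendicular bisector of $[P_i,P_{i+1}]$ (indices modulo $n$). Almost surely these $n$ lines are pairwise distinct and contain none of the points; they all pass through the center of the circle and divide the plane into $2n$ regions. The antipodal region of a region is its image under $z\mapsto -z$. For $k\in\{0,1,2\}$, a region is of type $k$ if the total number of points $P_j$ contained in the union of the region with its antipodal region is $k$. The length of a region is the length of the arc of the circle contained in it, with distances on the circle rescaled so that the total length of the circle is $1$. $L_{k,n}$ is the sum of the lengths of all regions of type $k$. *)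

theory Defs
  imports "HOL-Probability.Probability"
begin

definition circle_borel :: "complex measure" where
  "circle_borel = restrict_space borel (sphere 0 1)"

definition uniform_circle :: "complex measure" where
  "uniform_circle = distr (uniform_measure lborel {0..<1}) circle_borel (\<lambda>t. cis (2 * pi * t))"

(* Counterclockwise order starting from the positive real axis; the starting point
   is immaterial, since indices are only ever used cyclically. *)
definition ccw_points :: "nat \<Rightarrow> (nat \<Rightarrow> complex) \<Rightarrow> complex list" where
  "ccw_points n x = sort_key Arg2pi (map x [0..<n])"

(* A line if p and q are distinct, the whole plane if p = q. *)
definition perp_bisector :: "complex \<Rightarrow> complex \<Rightarrow> complex set" where
  "perp_bisector p q = {z. (z - midpoint p q) \<bullet> (q - p) = 0}"

definition bisectors :: "complex list \<Rightarrow> complex set set" where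
  "bisectors ps = (\<lambda>i. perp_bisector (ps ! i) (ps ! (Suc i mod length ps))) ` {..<length ps}"

definition regions :: "complex list \<Rightarrow> complex set set" where
  "regions ps = components (- \<Union> (bisectors ps))"

definition antipodal :: "complex set \<Rightarrow> complex set" where
  "antipodal R = uminus ` R"

definition region_type :: "complex list \<Rightarrow> complex set \<Rightarrow> nat" where
  "region_type ps R = card {j. j < length ps \<and> ps ! j \<in> R \<union> antipodal R}"

(* Arc length of the part of the unit circle inside R, the whole circle having length 1. *)
definition region_length :: "complex set \<Rightarrow> real" where
  "region_length R = measure lborel {t \<in> {0..<1}. cis (2 * pi * t) \<in> R}"

definition total_length :: "nat \<Rightarrow> complex list \<Rightarrow> real" where
  "total_length k ps = (\<Sum>R \<in> {R \<in> regions ps. region_type ps R = k}. region_length R)"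

end

theory Submission
  imports Defs
begin

text \<open>For distinct points the function \<open>z \<bullet> _\<close> rises and falls exactly once along the cyclic order, so \<open>z\<close>
  avoids the bisectors of neighbours iff \<open>z \<bullet> _\<close> has a unique maximum \<open>p\<close> and a unique minimum \<open>q\<close>
  on the points. Hence the regions are the nonempty cells of vectors \<open>z\<close> with nearest point \<open>p\<close>
  and farthest point \<open>q\<close>; such a cell can contain only the point \<open>p\<close>, and its antipode only \<open>q\<close>.

  So the expected lengths follow from the probability that a uniform \<open>z\<close> lies in the cell of the
  \<open>i\<close>-th and the \<open>j\<close>-th point, without further condition, or with one or both of these points in
  the double region. By rotation invariance \<open>z = 1\<close>. For fixed \<open>p = cis (2\<pi>x)\<close> and
  \<open>q = - cis (2\<pi>y)\<close> the other \<open>n - 2\<close> points range independently over a union of two arcs, whose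
  length is piecewise linear in \<open>x\<close> and \<open>y\<close>; its \<open>(n - 2)\<close>-th power is integrated over
  \<open>\<bar>x\<bar> + \<bar>y\<bar> < 1/2\<close>. The powers of \<open>1/3\<close> come from the configurations in which these
  two arcs just fail to shrink to one.\<close>

section \<open>Regions as cells\<close>

text \<open>The regions are defined through the order of the points by angle, whereas the product
  measure knows only labels. A cell depends on the set of points alone, so the total length becomes
  a sum over ordered pairs of labels, and by exchangeability all \<open>n * (n - 1)\<close> pairs
  contribute equally.

  A point is strictly nearest to itself, so \<open>p\<close> lies in its own cell iff
  \<open>q\<close> is farthest from \<open>p\<close>, and dually for \<open>q\<close>. Thus the type
  of a region is again a matter of comparing inner products, one remaining point at a time, and the
  three types follow by inclusion and exclusion from three probabilities: no condition, one
  condition, both.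

  In the final formulas the term linear in \<open>n\<close> has a single source, the integral with
  both conditions. For \<open>x\<close> and \<open>y\<close> of opposite sign the integrand there
  depends only on the difference of \<open>x\<close> and \<open>y\<close>, so it takes the value at
  its break, 1/3, along a whole segment; the other sectors only give cones over a break
  point.\<close>

text \<open>For unit \<open>r\<close> the squared distance from \<open>z\<close> to \<open>r\<close>
  is \<open>(norm z)^2 + 1 - 2 * (z \<bullet> r)\<close>, so this is the nearest-point Voronoi cell
  of \<open>p\<close> intersected with the farthest-point Voronoi cell of \<open>q\<close>. Written
  with inner products it is visibly an intersection of open half-planes.\<close>

definition cell :: "complex set \<Rightarrow> complex \<Rightarrow> complex \<Rightarrow> complex set" where
  "cell S p q = {z. (\<forall>r\<in>S - {p}. z \<bullet> r < z \<bullet> p) \<and> (\<forall>r\<in>S - {q}. z \<bullet> q < z \<bullet> r)}"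

lemma open_cell:
  assumes "finite S" shows "open (cell S p q)"
proof -
  have "cell S p q = (\<Inter>r\<in>S - {p}. {z. z \<bullet> r < z \<bullet> p}) \<inter> (\<Inter>r\<in>S - {q}. {z. z \<bullet> q < z \<bullet> r})"
    unfolding cell_def by auto
  moreover have "open \<dots>"
    using assms by (intro open_Int open_INT ballI open_Collect_less continuous_intros) auto
  ultimately show ?thesis by simp
qed

lemma convex_cell: "convex (cell S p q)"
proof -
  have "cell S p q = (\<Inter>r\<in>S - {p}. {z. (p - r) \<bullet> z > 0}) \<inter> (\<Inter>r\<in>S - {q}. {z. (r - q) \<bullet> z > 0})"
    unfolding cell_def by (auto simp: inner_diff_left inner_diff_right inner_commute)
  moreover have "convex \<dots>"
    by (intro convex_Int convex_INT ballI convex_halfspace_gt)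
  ultimately show ?thesis by simp
qed

lemma cell_unique:
  assumes "z \<in> cell S p q" "z \<in> cell S p' q'" "p \<in> S" "q \<in> S" "p' \<in> S" "q' \<in> S"
  shows "p = p' \<and> q = q'"
proof (rule ccontr)
  assume "\<not> (p = p' \<and> q = q')"
  then have "(p \<noteq> p' \<and> z \<bullet> p < z \<bullet> p' \<and> z \<bullet> p' < z \<bullet> p) \<or> (q \<noteq> q' \<and> z \<bullet> q < z \<bullet> q' \<and> z \<bullet> q' < z \<bullet> q)"
    using assms unfolding cell_def by blast
  then show False by auto
qed

lemma cell_diag:
  assumes "p \<in> S" "r \<in> S" "r \<noteq> p" shows "cell S p p = {}"
  proof -
  have False if "z \<in> cell S p p" for z
    using that assms unfolding cell_def by (force dest: bspec[of _ _ r])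
  then show ?thesis by auto
qed

lemma uminus_mem_cell: "- z \<in> cell S p q \<longleftrightarrow> z \<in> cell S q p"
  unfolding cell_def by auto

lemma inner_unit_less:
  fixes p r :: complex
  assumes "norm p = 1" "norm r = 1" "p \<noteq> r"
  shows "p \<bullet> r < 1"
proof -
  have "(p - r) \<bullet> (p - r) > 0" using assms(3) by simp
  moreover have "p \<bullet> p = 1" "r \<bullet> r = 1" using assms by (simp_all add: dot_square_norm)
  ultimately show ?thesis by (simp add: inner_diff_left inner_diff_right inner_commute)
qed

text \<open>Strict Cauchy-Schwarz: among unit vectors, \<open>s \<bullet> _\<close> is largest at
  \<open>s\<close> itself and nowhere else.\<close>

lemma unit_self_mem_cell_iff:
  assumes "S \<subseteq> sphere 0 1" "p \<in> S" "q \<in> S" "s \<in> S" "s \<in> cell S p q"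
  shows "s = p"
proof (rule ccontr)
  assume "s \<noteq> p"
  then have "s \<bullet> s < s \<bullet> p" using assms unfolding cell_def by blast
  moreover have "s \<bullet> s = 1" "s \<bullet> p < 1"
    using assms \<open>s \<noteq> p\<close> by (auto simp: dot_square_norm intro!: inner_unit_less)
  ultimately show False by simp
qed

section \<open>Bisectors through the center and orientation of chords\<close>

lemma perp_bisector_unit:
  assumes "norm p = 1" "norm q = 1"
  shows "perp_bisector p q = {z. z \<bullet> p = z \<bullet> q}"
proof -
  have "p \<bullet> p = 1" "q \<bullet> q = 1" using assms by (simp_all add: dot_square_norm)
  then show ?thesis
    unfolding perp_bisector_def midpoint_def
    by (auto simp: inner_diff_left inner_diff_right inner_add_left inner_add_right inner_commute)
qed

text \<open>The determinant of two plane vectors; \<open>cross (b - a) (c - a)\<close> is positive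
  iff \<open>c\<close> lies to the left of the directed line from \<open>a\<close> to
  \<open>b\<close>.\<close>

definition cross :: "complex \<Rightarrow> complex \<Rightarrow> real" where
  "cross a b = Re a * Im b - Im a * Re b"

text \<open>The chord from angle \<open>a\<close> to angle \<open>a + 2 * w\<close> is
  \<open>2 * sin w\<close> times the unit vector at angle \<open>a + w + pi/2\<close>. Two chords
  from the same point therefore enclose the difference of the two half-angles, which gives the third
  sine.\<close>

lemma cross_cis:
  "cross (cis b - cis a) (cis c - cis a) =
     4 * sin ((b - a) / 2) * sin ((c - b) / 2) * sin ((c - a) / 2)"
proof -
  define u v where "u = (b - a) / 2" and "v = (c - a) / 2"
  have b: "b = a + 2 * u" and c: "c = a + 2 * v" unfolding u_def v_def by (auto simp: field_simps)
  have vu: "(c - b) / 2 = v - u" unfolding u_def v_def by (simp add: field_simps)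
  have d: "cis (a + 2 * w) - cis a = cis a * Complex (- 2 * sin w * sin w) (2 * sin w * cos w)" for w
  proof -
    have "cos (2 * w) - 1 = - 2 * sin w * sin w"
      using cos_double_sin[of w] by (simp add: power2_eq_square)
    then have "cis (2 * w) - 1 = Complex (- 2 * sin w * sin w) (2 * sin w * cos w)"
      using sin_double[of w] by (simp add: complex_eq_iff)
    then show ?thesis by (metis cis_mult mult.right_neutral right_diff_distrib)
  qed
  have rot: "cross (e * f) (e * g) = (norm e)\<^sup>2 * cross f g" for e f g
    unfolding cross_def cmod_power2 by (simp add: algebra_simps power2_eq_square)
  have "cross (cis b - cis a) (cis c - cis a) =
      4 * sin u * sin v * (sin v * cos u - cos v * sin u)"
    unfolding b c d rot by (simp add: cross_def algebra_simps)
  also have "\<dots> = 4 * sin u * sin (v - u) * sin v" by (simp add: sin_diff algebra_simps)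
  finally show ?thesis unfolding vu u_def v_def .
qed

text \<open>For angles in [0, 2 pi) every half-difference lies strictly between -pi and pi, so each
  sine factor has the sign of its difference. This and the next two lemmas treat \<open>c\<close>
  before, between and after the ends of the chord.\<close>

lemma cross_chord_pos:
  assumes "0 \<le> c" "c < a" "a < b" "b < 2 * pi"
  shows "cross (cis b - cis a) (cis c - cis a) > 0"
proof -
  have "sin ((b - a) / 2) > 0" using assms by (intro sin_gt_zero) auto
  moreover have "sin ((b - c) / 2) > 0" using assms by (intro sin_gt_zero) auto
  moreover have "sin ((a - c) / 2) > 0" using assms by (intro sin_gt_zero) auto
  moreover have "sin ((c - b) / 2) = - sin ((b - c) / 2)" "sin ((c - a) / 2) = - sin ((a - c) / 2)"
    by (metis minus_diff_eq minus_divide_left sin_minus)+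
  ultimately show ?thesis unfolding cross_cis by simp
qed

lemma cross_chord_neg:
  assumes "0 \<le> a" "a < c" "c < b" "b < 2 * pi"
  shows "cross (cis b - cis a) (cis c - cis a) < 0"
proof -
  have "sin ((b - a) / 2) > 0" using assms by (intro sin_gt_zero) auto
  moreover have "sin ((b - c) / 2) > 0" using assms by (intro sin_gt_zero) auto
  moreover have "sin ((c - a) / 2) > 0" using assms by (intro sin_gt_zero) auto
  moreover have "sin ((c - b) / 2) = - sin ((b - c) / 2)"
    by (metis minus_diff_eq minus_divide_left sin_minus)
  ultimately show ?thesis unfolding cross_cis by (simp add: mult_pos_pos)
qed

lemma cross_chord_pos':
  assumes "0 \<le> a" "a < b" "b < c" "c < 2 * pi"
  shows "cross (cis b - cis a) (cis c - cis a) > 0"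
proof -
  have "sin ((b - a) / 2) > 0" using assms by (intro sin_gt_zero) auto
  moreover have "sin ((c - b) / 2) > 0" using assms by (intro sin_gt_zero) auto
  moreover have "sin ((c - a) / 2) > 0" using assms by (intro sin_gt_zero) auto
  ultimately show ?thesis unfolding cross_cis by simp
qed

text \<open>In the plane a vector orthogonal to the chord \<open>q - p\<close> is a multiple of the
  chord turned by a right angle, and the inner product with the turned chord is
  \<open>cross\<close>. So \<open>z \<bullet> _\<close> compares points exactly as their side of the
  chord does, up to one global sign.\<close>

lemma inner_eq_cross:
  assumes "z \<bullet> p = z \<bullet> q" "p \<noteq> q" "z \<noteq> 0"
  obtains l where "l \<noteq> 0" "\<And>r. z \<bullet> r - z \<bullet> p = l * cross (q - p) (r - p)"
proof -
  define d where "d = q - p"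
  have zd: "Re z * Re d + Im z * Im d = 0" "d \<noteq> 0"
    using assms unfolding d_def by (auto simp: inner_complex_def algebra_simps)
  \<comment> \<open>The coefficient of \<open>z\<close> along the turned chord, obtained by
    projecting.\<close>
  define l where "l = (Im z * Re d - Re z * Im d) / (norm d)\<^sup>2"
  have nz: "(norm d)\<^sup>2 \<noteq> 0" using zd by simp
  have nd: "(norm d)\<^sup>2 = Re d * Re d + Im d * Im d" by (simp only: cmod_power2 power2_eq_square[of "Re d"] power2_eq_square[of "Im d"])
  have "l * (norm d)\<^sup>2 = Im z * Re d - Re z * Im d" unfolding l_def using nz by simp
  then have lin: "- l * Im d * (norm d)\<^sup>2 = Re z * (norm d)\<^sup>2" "l * Re d * (norm d)\<^sup>2 = Im z * (norm d)\<^sup>2"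
    using zd(1) unfolding nd by algebra+
  then have zz: "Re z = - l * Im d" "Im z = l * Re d" using nz by (metis mult_right_cancel)+
  have "z \<bullet> r - z \<bullet> p = l * cross (q - p) (r - p)" for r
  proof -
    have "z \<bullet> r - z \<bullet> p = Re z * Re (r - p) + Im z * Im (r - p)"
      by (simp add: inner_complex_def algebra_simps)
    also have "\<dots> = l * cross d (r - p)" unfolding zz cross_def by (simp add: algebra_simps)
    finally show ?thesis unfolding d_def .
  qed
  moreover have "l \<noteq> 0"
    using zz \<open>z \<noteq> 0\<close> by (auto simp: complex_eq_iff)
  ultimately show ?thesis using that by blast
qed

text \<open>The deterministic setting: strict monotonicity of the angles encodes both the cyclic
  order and the distinctness of the points.\<close>

locale ccw_list =
  fixes ps :: "complex list"
  assumes unit: "set ps \<subseteq> sphere 0 1"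
    and mono: "\<And>a b. a < b \<Longrightarrow> b < length ps \<Longrightarrow> Arg2pi (ps ! a) < Arg2pi (ps ! b)"
    and long: "length ps \<ge> 3"
begin

abbreviation "S \<equiv> set ps"
abbreviation "N \<equiv> length ps"
abbreviation ang :: "nat \<Rightarrow> real" where "ang a \<equiv> Arg2pi (ps ! a)"

lemma norm_nth: "a < N \<Longrightarrow> norm (ps ! a) = 1"
  using unit nth_mem by fastforce

lemma nth_eq_cis: "a < N \<Longrightarrow> ps ! a = cis (ang a)"
  using Arg2pi_eq[of "ps ! a"] norm_nth[of a] by (simp add: cis_conv_exp)

lemma ang_range: "0 \<le> ang a" "ang a < 2 * pi"
  using Arg2pi[of "ps ! a"] by auto

lemma nth_inj: "a < N \<Longrightarrow> b < N \<Longrightarrow> ps ! a = ps ! b \<Longrightarrow> a = b"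
  using mono[of a b] mono[of b a] by (metis less_irrefl nat_neq_iff)

lemma distinct_nth: "ps ! 0 \<in> S" "ps ! 1 \<in> S" "ps ! 0 \<noteq> ps ! 1"
proof -
  have "0 < N" "1 < N" using long by linarith+
  then show "ps ! 0 \<in> S" "ps ! 1 \<in> S" "ps ! 0 \<noteq> ps ! 1"
    using nth_mem[of 0 ps] nth_mem[of 1 ps] nth_inj[of 0 1] by (simp, simp, auto)
qed

lemma cross_nth:
  assumes "a < N" "b < N" "c < N"
  shows "cross (ps ! b - ps ! a) (ps ! c - ps ! a) =
    cross (cis (ang b) - cis (ang a)) (cis (ang c) - cis (ang a))"
  using assms nth_eq_cis by metis

lemma cross_between:
  assumes "a < c" "c < b" "b < N"
  shows "cross (ps ! b - ps ! a) (ps ! c - ps ! a) < 0"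
proof -
  have "ang a < ang c" "ang c < ang b" using assms by (auto intro!: mono)
  then show ?thesis
    using assms ang_range[of a] ang_range[of b] by (simp only: cross_nth cross_chord_neg)
qed

lemma cross_outside:
  assumes "a < b" "b < N" "c < N" "c < a \<or> b < c"
  shows "cross (ps ! b - ps ! a) (ps ! c - ps ! a) > 0"
proof -
  have *: "cross (ps ! b - ps ! a) (ps ! c - ps ! a) =
      cross (cis (ang b) - cis (ang a)) (cis (ang c) - cis (ang a))"
    using assms by (intro cross_nth) auto
  have ab: "ang a < ang b" using assms by (intro mono) auto
  from assms(4) show ?thesis
  proof
    assume "c < a"
    then have "ang c < ang a" using assms by (intro mono) auto
    then show ?thesis unfolding * using ab ang_range by (intro cross_chord_pos) auto
  next
    assume "b < c"
    then have "ang b < ang c" using assms by (intro mono) auto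
    then show ?thesis unfolding * using ab ang_range by (intro cross_chord_pos') auto
  qed
qed

lemma bisectors_eq:
  "\<Union> (bisectors ps) = {z. \<exists>a<N. z \<bullet> ps ! a = z \<bullet> ps ! (Suc a mod N)}"
proof -
  have *: "perp_bisector (ps ! a) (ps ! (Suc a mod N)) = {z. z \<bullet> ps ! a = z \<bullet> ps ! (Suc a mod N)}"
    if "a < N" for a
    using that by (intro perp_bisector_unit norm_nth) (auto intro: mod_less_divisor)
  show ?thesis unfolding bisectors_def using * by auto
qed

text \<open>Two neighbours with equal inner product \<open>z \<bullet> _\<close> span a chord orthogonal to \<open>z\<close> with all other
  points on one side, so they tie for the maximum or for the minimum. Conversely a chord joining
  two points that tie for an extremum has no points on one side.\<close>

lemma neighbours_tie:
  assumes "z \<noteq> 0" "a < b" "b < N" "Suc a = b \<or> (a = 0 \<and> Suc b = N)" "z \<bullet> ps ! a = z \<bullet> ps ! b"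
  shows "(\<forall>r\<in>S. z \<bullet> r \<le> z \<bullet> ps ! a) \<or> (\<forall>r\<in>S. z \<bullet> r \<ge> z \<bullet> ps ! a)"
proof -
  have "ps ! a \<noteq> ps ! b" using assms(2,3) nth_inj[of a b] by auto
  then obtain l where l: "l \<noteq> 0" "\<And>r. z \<bullet> r - z \<bullet> ps ! a = l * cross (ps ! b - ps ! a) (r - ps ! a)"
    using inner_eq_cross[OF assms(5) _ assms(1)] by metis
  have zero: "z \<bullet> ps ! b - z \<bullet> ps ! a = 0" using assms by simp
  consider (pos) "\<forall>c<N. c \<noteq> a \<and> c \<noteq> b \<longrightarrow> cross (ps ! b - ps ! a) (ps ! c - ps ! a) > 0"
    | (neg) "\<forall>c<N. c \<noteq> a \<and> c \<noteq> b \<longrightarrow> cross (ps ! b - ps ! a) (ps ! c - ps ! a) < 0"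
  proof (cases "Suc a = b")
    case True
    have "c < a \<or> b < c" if "c \<noteq> a" "c \<noteq> b" for c using that True by linarith
    then show ?thesis using cross_outside[OF assms(2,3)] pos by blast
  next
    case False
    then have "a < c \<and> c < b" if "c < N" "c \<noteq> a" "c \<noteq> b" for c using that assms by linarith
    then show ?thesis using cross_between[OF _ _ assms(3)] neg by blast
  qed
  then have "(\<forall>c<N. z \<bullet> ps ! c \<le> z \<bullet> ps ! a) \<or> (\<forall>c<N. z \<bullet> ps ! c \<ge> z \<bullet> ps ! a)"
  proof cases
    case pos
    then have "z \<bullet> ps ! c = z \<bullet> ps ! a \<or> (z \<bullet> ps ! c - z \<bullet> ps ! a > 0 \<longleftrightarrow> l > 0)" if "c < N" for c
      using that l(2)[of "ps ! c"] zero by (metis eq_iff_diff_eq_0 zero_less_mult_pos2 mult_pos_pos)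
    then show ?thesis using l(1) by (metis diff_gt_0_iff_gt leI order.strict_implies_order order_refl)
  next
    case neg
    then have "z \<bullet> ps ! c = z \<bullet> ps ! a \<or> (z \<bullet> ps ! c - z \<bullet> ps ! a > 0 \<longleftrightarrow> l < 0)" if "c < N" for c
      using that l(2)[of "ps ! c"] zero by (metis eq_iff_diff_eq_0 zero_less_mult_iff order_less_asym)
    then show ?thesis using l(1) by (metis diff_gt_0_iff_gt leI order.strict_implies_order order_refl)
  qed
  then show ?thesis by (metis in_set_conv_nth)
qed

lemma tie_neighbours:
  assumes "z \<noteq> 0" "a < b" "b < N" "z \<bullet> ps ! a = z \<bullet> ps ! b"
    and ext: "(\<forall>r\<in>S. z \<bullet> r \<le> z \<bullet> ps ! a) \<or> (\<forall>r\<in>S. z \<bullet> r \<ge> z \<bullet> ps ! a)"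
  shows "Suc a = b \<or> (a = 0 \<and> Suc b = N)"
proof (rule ccontr)
  assume neg: "\<not> ?thesis"
  \<comment> \<open>\<open>c\<close> lies strictly between \<open>a\<close> and \<open>b\<close>,
    \<open>d\<close> on the complementary arc; both exist because \<open>a\<close> and
    \<open>b\<close> are not cyclic neighbours. They lie on opposite sides of the chord, so one has
    a larger and the other a smaller inner product than the tied points.\<close>
  define c where "c = Suc a"
  define d where "d = (if a = 0 then Suc b else 0)"
  have c: "a < c" "c < b" "c < N" using neg assms(2,3) unfolding c_def by auto
  have d: "d < a \<or> b < d" "d < N" using neg assms(2,3) unfolding d_def by auto
  have "ps ! a \<noteq> ps ! b" using assms(2,3) nth_inj[of a b] by auto
  then obtain l where l: "l \<noteq> 0" "\<And>r. z \<bullet> r - z \<bullet> ps ! a = l * cross (ps ! b - ps ! a) (r - ps ! a)"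
    using inner_eq_cross[OF assms(4) _ assms(1)] by metis
  define f where "f = (\<lambda>r. cross (ps ! b - ps ! a) (r - ps ! a))"
  have f: "f (ps ! c) < 0" "f (ps ! d) > 0"
    using cross_between[OF c(1,2) assms(3)] cross_outside[OF assms(2,3) d(2,1)] unfolding f_def by auto
  have lf: "z \<bullet> ps ! c - z \<bullet> ps ! a = l * f (ps ! c)" "z \<bullet> ps ! d - z \<bullet> ps ! a = l * f (ps ! d)"
    using l(2) unfolding f_def by auto
  from ext show False
  proof
    assume "\<forall>r\<in>S. z \<bullet> r \<le> z \<bullet> ps ! a"
    then have "l * f (ps ! c) \<le> 0" "l * f (ps ! d) \<le> 0"
      using lf c(3) d(2) nth_mem by (metis diff_le_0_iff_le)+
    then show False using f l(1) by (auto simp: mult_le_0_iff)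
  next
    assume "\<forall>r\<in>S. z \<bullet> r \<ge> z \<bullet> ps ! a"
    then have "l * f (ps ! c) \<ge> 0" "l * f (ps ! d) \<ge> 0"
      using lf c(3) d(2) nth_mem by (metis diff_ge_0_iff_ge)+
    then show False using f l(1) by (auto simp: zero_le_mult_iff)
  qed
qed

text \<open>Off the bisectors neither extremum of \<open>z \<bullet> _\<close> is attained twice,
  since tied extremal points are neighbours. Conversely, on a bisector two neighbours tie for an
  extremum, which membership in a cell excludes.\<close>

lemma bisectors_compl: "- \<Union> (bisectors ps) = (\<Union>(p, q)\<in>S \<times> S. cell S p q)"
proof (intro equalityI subsetI)
  fix z assume "z \<in> - \<Union> (bisectors ps)"
  then have "\<not> (\<exists>a<N. z \<bullet> ps ! a = z \<bullet> ps ! (Suc a mod N))"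
    unfolding bisectors_eq by simp
  then have off: "z \<bullet> ps ! a \<noteq> z \<bullet> ps ! (Suc a mod N)" if "a < N" for a
    using that by blast
  have "0 < N" using long by linarith
  \<comment> \<open>The origin lies on every bisector.\<close>
  then have z: "z \<noteq> 0" using off[of 0] by (metis inner_zero_left)
  have ne: "S \<noteq> {}" using distinct_nth(1) by auto
  obtain p where p: "p \<in> S" "\<forall>r\<in>S. z \<bullet> r \<le> z \<bullet> p"
    using finite_has_maximal[of "(\<bullet>) z ` S"] ne by fastforce
  obtain q where q: "q \<in> S" "\<forall>r\<in>S. z \<bullet> q \<le> z \<bullet> r"
    using finite_has_minimal[of "(\<bullet>) z ` S"] ne by fastforce
  have tie: "False" if "a < N" "b < N" "a < b" "z \<bullet> ps ! a = z \<bullet> ps ! b"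
    "(\<forall>r\<in>S. z \<bullet> r \<le> z \<bullet> ps ! a) \<or> (\<forall>r\<in>S. z \<bullet> r \<ge> z \<bullet> ps ! a)" for a b
  proof -
    have "Suc a = b \<or> (a = 0 \<and> Suc b = N)" using tie_neighbours[OF z that(3,2,4,5)] .
    then show False
    proof
      assume "Suc a = b" then show False using off[of a] that by simp
    next
      \<comment> \<open>The pair across the end of the list is indexed by its larger element:
        \<open>Suc b mod N = 0\<close>.\<close>
      assume "a = 0 \<and> Suc b = N" then show False using off[of b] that by simp
    qed
  qed
  have tie': "r = s" if rs: "r \<in> S" "s \<in> S" "z \<bullet> r = z \<bullet> s"
    "(\<forall>t\<in>S. z \<bullet> t \<le> z \<bullet> r) \<or> (\<forall>t\<in>S. z \<bullet> t \<ge> z \<bullet> r)" for r s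
  proof -
    obtain a b where ab: "a < N" "b < N" "r = ps ! a" "s = ps ! b"
      using rs by (metis in_set_conv_nth)
    have "\<not> a < b" "\<not> b < a" using tie[of a b] tie[of b a] rs ab by auto
    then show ?thesis using ab by simp
  qed
  have "z \<in> cell S p q"
    unfolding cell_def
  proof (clarify, intro conjI ballI)
    fix r assume "r \<in> S - {p}"
    then show "z \<bullet> r < z \<bullet> p" using tie'[of p r] p by force
  next
    fix r assume "r \<in> S - {q}"
    then show "z \<bullet> q < z \<bullet> r" using tie'[of q r] q by force
  qed
  then show "z \<in> (\<Union>(p, q)\<in>S \<times> S. cell S p q)" using p q by auto
next
  fix z assume "z \<in> (\<Union>(p, q)\<in>S \<times> S. cell S p q)"
  then obtain p q where pq: "p \<in> S" "q \<in> S" "z \<in> cell S p q" by auto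
  have P: "z \<bullet> r < z \<bullet> p" if "r \<in> S" "r \<noteq> p" for r using pq that unfolding cell_def by auto
  have Q: "z \<bullet> q < z \<bullet> r" if "r \<in> S" "r \<noteq> q" for r using pq that unfolding cell_def by auto
  have ne: "ps ! 0 \<in> S" "ps ! 1 \<in> S" "ps ! 0 \<noteq> ps ! 1" using distinct_nth by auto
  have z: "z \<noteq> 0" using P Q ne by (metis inner_zero_left less_irrefl)
  have no_tie: "\<not> ((\<forall>t\<in>S. z \<bullet> t \<le> z \<bullet> r) \<or> (\<forall>t\<in>S. z \<bullet> t \<ge> z \<bullet> r))"
    if "r \<in> S" "s \<in> S" "r \<noteq> s" "z \<bullet> r = z \<bullet> s" for r s
  proof (rule notI, erule disjE)
    assume "\<forall>t\<in>S. z \<bullet> t \<le> z \<bullet> r"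
    then have "r = p" "s = p" using P[of r] P[of s] pq(1) that by force+
    then show False using that by simp
  next
    assume "\<forall>t\<in>S. z \<bullet> t \<ge> z \<bullet> r"
    then have "r = q" "s = q" using Q[of r] Q[of s] pq(2) that by force+
    then show False using that by simp
  qed
  have "z \<bullet> ps ! a \<noteq> z \<bullet> ps ! (Suc a mod N)" if a: "a < N" for a
  proof
    assume eq: "z \<bullet> ps ! a = z \<bullet> ps ! (Suc a mod N)"
    show False
    proof (cases "Suc a < N")
      case True
      have "ps ! a \<noteq> ps ! Suc a" using True nth_inj[of a "Suc a"] by auto
      then show False using neighbours_tie[OF z, of a "Suc a"] True eq no_tie[of "ps ! a" "ps ! Suc a"] by simp
    next
      case False
      then have "Suc a = N" using a by simp
      then have "0 < a" "0 < N" using long by linarith+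
      have eq': "z \<bullet> ps ! 0 = z \<bullet> ps ! a" using eq \<open>Suc a = N\<close> by simp
      have "ps ! 0 \<noteq> ps ! a" using nth_inj[OF \<open>0 < N\<close> a] \<open>0 < a\<close> by (metis less_irrefl)
      then show False
        using no_tie[OF nth_mem[OF \<open>0 < N\<close>] nth_mem[OF a] _ eq']
          neighbours_tie[OF z \<open>0 < a\<close> a _ eq'] \<open>Suc a = N\<close> by blast
    qed
  qed
  then show "z \<in> - \<Union> (bisectors ps)" unfolding bisectors_eq by blast
qed

text \<open>The nonempty cells are open, convex and pairwise disjoint with union the complement of
  the bisectors; a partition into open connected sets is the partition into components.\<close>

lemma regions_eq: "regions ps = (\<lambda>(p, q). cell S p q) ` (S \<times> S) - {{}}"
proof -
  have "components (- \<Union> (bisectors ps)) = (\<lambda>(p, q). cell S p q) ` (S \<times> S) - {{}}"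
  proof (rule components_open_unique)
    show "\<Union> ((\<lambda>(p, q). cell S p q) ` (S \<times> S) - {{}}) = - \<Union> (bisectors ps)"
      unfolding bisectors_compl by blast
    show "pairwise disjnt ((\<lambda>(p, q). cell S p q) ` (S \<times> S) - {{}})"
    proof (rule pairwiseI)
      fix A B
      assume AB: "A \<in> (\<lambda>(p, q). cell S p q) ` (S \<times> S) - {{}}"
        "B \<in> (\<lambda>(p, q). cell S p q) ` (S \<times> S) - {{}}" "A \<noteq> B"
      then obtain p q p' q' where "p \<in> S" "q \<in> S" "p' \<in> S" "q' \<in> S"
        "A = cell S p q" "B = cell S p' q'" by auto
      then show "disjnt A B"
        unfolding disjnt_iff using cell_unique[of _ S p q p' q'] AB(3) by blast
    qed
    show "open X \<and> connected X \<and> X \<noteq> {}" if "X \<in> (\<lambda>(p, q). cell S p q) ` (S \<times> S) - {{}}" for X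
      using that by (auto simp: open_cell convex_cell convex_connected)
  qed
  then show ?thesis unfolding regions_def .
qed

text \<open>Negating \<open>z\<close> reverses the order of all inner products, so the antipodal
  region is the cell with \<open>p\<close> and \<open>q\<close> exchanged. Each of the two
  contributes at most one point, and \<open>p \<noteq> q\<close> prevents double counting.\<close>

lemma region_type_cell:
  assumes "p \<in> S" "q \<in> S" "p \<noteq> q"
  shows "region_type ps (cell S p q) = of_bool (p \<in> cell S p q) + of_bool (q \<in> cell S q p)"
proof -
  have anti: "s \<in> antipodal (cell S p q) \<longleftrightarrow> s \<in> cell S q p" for s
    unfolding antipodal_def using uminus_mem_cell by (metis (no_types, lifting) imageE imageI minus_minus)
  have "region_type ps (cell S p q) = card {s \<in> S. s \<in> cell S p q \<or> s \<in> cell S q p}"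
    unfolding region_type_def
  proof (rule bij_betw_same_card, rule bij_betw_imageI)
    show "inj_on ((!) ps) {j. j < N \<and> ps ! j \<in> cell S p q \<union> antipodal (cell S p q)}"
      using nth_inj unfolding inj_on_def by blast
    show "(!) ps ` {j. j < N \<and> ps ! j \<in> cell S p q \<union> antipodal (cell S p q)} =
      {s \<in> S. s \<in> cell S p q \<or> s \<in> cell S q p}"
      by (auto simp: anti in_set_conv_nth image_iff)
  qed
  also have "{s \<in> S. s \<in> cell S p q \<or> s \<in> cell S q p} =
      (if p \<in> cell S p q then {p} else {}) \<union> (if q \<in> cell S q p then {q} else {})"
    using unit_self_mem_cell_iff[OF unit] assms by auto
  also have "card \<dots> = of_bool (p \<in> cell S p q) + of_bool (q \<in> cell S q p)"
    using assms by auto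
  finally show ?thesis .
qed

text \<open>A nonempty cell determines its pair, so regions may be replaced by pairs; pairs with an
  empty cell can be added freely, their length being 0.\<close>

lemma total_length_eq:
  "total_length k ps = (\<Sum>p\<in>S. \<Sum>q\<in>S - {p}.
     of_bool (of_bool (p \<in> cell S p q) + of_bool (q \<in> cell S q p) = k) * region_length (cell S p q))"
proof -
  define D where "D = {(p, q) \<in> S \<times> S. p \<noteq> q \<and> cell S p q \<noteq> {}
    \<and> of_bool (p \<in> cell S p q) + of_bool (q \<in> cell S q p) = k}"
  have "ps ! 0 \<in> S" "ps ! 1 \<in> S" "ps ! 0 \<noteq> ps ! 1" using distinct_nth by auto
  then have ex: "\<exists>r\<in>S. r \<noteq> p" for p by metis
  have diag: "cell S p p = {}" if "p \<in> S" for p using ex[of p] cell_diag that by metis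
  have "{R \<in> regions ps. region_type ps R = k} = (\<lambda>(p, q). cell S p q) ` D"
  proof (intro equalityI subsetI)
    fix R assume "R \<in> {R \<in> regions ps. region_type ps R = k}"
    then obtain p q where R: "p \<in> S" "q \<in> S" "R = cell S p q" "R \<noteq> {}" "region_type ps R = k"
      unfolding regions_eq by auto
    then have "p \<noteq> q" using diag by auto
    then have "(p, q) \<in> D" using R region_type_cell[of p q] unfolding D_def by auto
    then show "R \<in> (\<lambda>(p, q). cell S p q) ` D" using R by force
  next
    fix R assume "R \<in> (\<lambda>(p, q). cell S p q) ` D"
    then obtain p q where R: "(p, q) \<in> D" "R = cell S p q" by auto
    then have "p \<in> S" "q \<in> S" "p \<noteq> q" unfolding D_def by auto
    then show "R \<in> {R \<in> regions ps. region_type ps R = k}"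
      using R region_type_cell[of p q] unfolding regions_eq D_def by auto
  qed
  moreover have "inj_on (\<lambda>(p, q). cell S p q) D"
  proof (rule inj_onI, clarify)
    fix p q p' q' assume pq: "(p, q) \<in> D" "(p', q') \<in> D" "cell S p q = cell S p' q'"
    then obtain z where "z \<in> cell S p q" unfolding D_def by auto
    then show "p = p' \<and> q = q'" using pq cell_unique[of z S p q p' q'] unfolding D_def by auto
  qed
  ultimately have "total_length k ps = (\<Sum>(p, q)\<in>D. region_length (cell S p q))"
    unfolding total_length_def by (simp add: sum.reindex case_prod_unfold comp_def)
  also have "\<dots> = (\<Sum>(p, q)\<in>(SIGMA p:S. S - {p}).
     of_bool (of_bool (p \<in> cell S p q) + of_bool (q \<in> cell S q p) = k) * region_length (cell S p q))"
  proof (rule sum.mono_neutral_cong_left)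
    show "finite (SIGMA p:S. S - {p})" by simp
    show "D \<subseteq> (SIGMA p:S. S - {p})" unfolding D_def by auto
  qed (auto simp: D_def region_length_def)
  also have "\<dots> = (\<Sum>p\<in>S. \<Sum>q\<in>S - {p}.
     of_bool (of_bool (p \<in> cell S p q) + of_bool (q \<in> cell S q p) = k) * region_length (cell S p q))"
    by (subst sum.Sigma) (auto intro: sum.cong)
  finally show ?thesis .
qed

end

section \<open>The uniform distribution on the circle\<close>

lemma ccw_list_ccw_points:
  assumes "n \<ge> 3" "x ` {..<n} \<subseteq> sphere 0 1" "inj_on x {..<n}"
  shows "ccw_list (ccw_points n x)" "set (ccw_points n x) = x ` {..<n}"
proof -
  let ?ps = "ccw_points n x"
  show set: "set ?ps = x ` {..<n}" unfolding ccw_points_def by (auto simp: image_def)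
  have len: "length ?ps = n" unfolding ccw_points_def by simp
  have "distinct ?ps" unfolding ccw_points_def using assms(3)
    by (simp add: distinct_map lessThan_atLeast0)
  show "ccw_list ?ps"
  proof
    show "set ?ps \<subseteq> sphere 0 1" using set assms by simp
    show "length ?ps \<ge> 3" using len assms by simp
    fix a b assume ab: "a < b" "b < length ?ps"
    have "sorted (map Arg2pi ?ps)" unfolding ccw_points_def by simp
    then have le: "Arg2pi (?ps ! a) \<le> Arg2pi (?ps ! b)"
      using sorted_nth_mono[of "map Arg2pi ?ps" a b] ab by simp
    have ne: "?ps ! a \<noteq> ?ps ! b" using \<open>distinct ?ps\<close> ab by (simp add: nth_eq_iff_index_eq)
    have "?ps ! a \<in> sphere 0 1" "?ps ! b \<in> sphere 0 1"
      using ab set assms(2) nth_mem[of a ?ps] nth_mem[of b ?ps] by auto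
    then have "Arg2pi (?ps ! a) \<noteq> Arg2pi (?ps ! b)"
      using ne Arg2pi_eq[of "?ps ! a"] Arg2pi_eq[of "?ps ! b"] by auto
    then show "Arg2pi (?ps ! a) < Arg2pi (?ps ! b)" using le by simp
  qed
qed

text \<open>Two equal points become adjacent after sorting, and their bisector is then the whole
  plane, so no region is left. Although coincidence has probability 0, this yields a formula valid
  at every sample, from which measurability of the total length is read off.\<close>

lemma total_length_coincident:
  assumes "x ` {..<n} \<subseteq> sphere 0 1" "\<not> inj_on x {..<n}"
  shows "total_length k (ccw_points n x) = 0"
proof -
  let ?ps = "ccw_points n x"
  have "\<not> distinct ?ps" unfolding ccw_points_def using assms(2)
    by (simp add: distinct_map lessThan_atLeast0)
  then obtain a b where ab: "a < b" "b < length ?ps" "?ps ! a = ?ps ! b"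
    unfolding distinct_conv_nth by (metis nat_neq_iff)
  have "sorted (map Arg2pi ?ps)" unfolding ccw_points_def by simp
  \<comment> \<open>The entry after position \<open>a\<close> is squeezed between two equal
    angles.\<close>
  then have "Arg2pi (?ps ! a) \<le> Arg2pi (?ps ! Suc a)" "Arg2pi (?ps ! Suc a) \<le> Arg2pi (?ps ! b)"
    using sorted_nth_mono[of "map Arg2pi ?ps" a "Suc a"]
      sorted_nth_mono[of "map Arg2pi ?ps" "Suc a" b] ab by simp_all
  then have arg: "Arg2pi (?ps ! a) = Arg2pi (?ps ! Suc a)" using ab by simp
  have "set ?ps = x ` {..<n}" unfolding ccw_points_def by (auto simp: image_def)
  then have "?ps ! a \<in> sphere 0 1" "?ps ! Suc a \<in> sphere 0 1"
    using ab assms(1) nth_mem[of a ?ps] nth_mem[of "Suc a" ?ps] by auto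
  then have "?ps ! a = ?ps ! Suc a"
    using arg Arg2pi_eq[of "?ps ! a"] Arg2pi_eq[of "?ps ! Suc a"] by auto
  then have "perp_bisector (?ps ! a) (?ps ! (Suc a mod length ?ps)) = UNIV"
    using ab by (simp add: perp_bisector_def)
  moreover have "perp_bisector (?ps ! a) (?ps ! (Suc a mod length ?ps)) \<in> bisectors ?ps"
    unfolding bisectors_def using ab by (intro imageI) simp
  ultimately have "\<Union> (bisectors ?ps) = UNIV" by auto
  then show ?thesis unfolding total_length_def regions_def by simp
qed

text \<open>\<open>cell\<close> with conditions indexed by labels instead of points, so that each
  coordinate of the product space is constrained separately. If another label shares the point of
  \<open>i\<close> or of \<open>j\<close>, the set is empty.\<close>

definition icell :: "nat \<Rightarrow> (nat \<Rightarrow> complex) \<Rightarrow> nat \<Rightarrow> nat \<Rightarrow> complex set" where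
  "icell n x i j = {z. (\<forall>k<n. k \<noteq> i \<longrightarrow> z \<bullet> x k < z \<bullet> x i) \<and> (\<forall>k<n. k \<noteq> j \<longrightarrow> z \<bullet> x j < z \<bullet> x k)}"

lemma cell_eq_icell:
  assumes "inj_on x {..<n}" "i < n" "j < n"
  shows "cell (x ` {..<n}) (x i) (x j) = icell n x i j"
  using assms unfolding cell_def icell_def inj_on_def by auto

lemma total_length_ccw_points:
  assumes "n \<ge> 3" "x ` {..<n} \<subseteq> sphere 0 1"
  shows "total_length k (ccw_points n x) = of_bool (inj_on x {..<n}) * (\<Sum>i<n. \<Sum>j\<in>{..<n} - {i}.
     of_bool (of_bool (x i \<in> icell n x i j) + of_bool (x j \<in> icell n x j i) = k) *
     region_length (icell n x i j))"
proof (cases "inj_on x {..<n}")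
  case True
  interpret ccw_list "ccw_points n x" using ccw_list_ccw_points assms True by blast
  have S: "set (ccw_points n x) = x ` {..<n}" using ccw_list_ccw_points assms True by blast
  have D: "x ` {..<n} - {x i} = x ` ({..<n} - {i})" if "i < n" for i
    using True that unfolding inj_on_def by auto
  have I: "inj_on x ({..<n} - {i})" for i using True by (auto intro: inj_on_subset)
  have "(\<Sum>j\<in>{..<n} - {i}. g (cell (x ` {..<n}) (x i) (x j)) (x j) (cell (x ` {..<n}) (x j) (x i)))
      = (\<Sum>j\<in>{..<n} - {i}. g (icell n x i j) (x j) (icell n x j i))" if "i < n"
    for i and g :: "complex set \<Rightarrow> complex \<Rightarrow> complex set \<Rightarrow> real"
    using that True by (intro sum.cong) (simp_all add: cell_eq_icell)
  then have *: "(\<Sum>q\<in>x ` {..<n} - {x i}. g (cell (x ` {..<n}) (x i) q) q (cell (x ` {..<n}) q (x i)))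
      = (\<Sum>j\<in>{..<n} - {i}. g (icell n x i j) (x j) (icell n x j i))" if "i < n"
    for i and g :: "complex set \<Rightarrow> complex \<Rightarrow> complex set \<Rightarrow> real"
    using that by (simp only: D sum.reindex[OF I] comp_def)
  show ?thesis
    unfolding total_length_eq S sum.reindex[OF True] comp_def using True
    by (simp only: of_bool_eq mult_1_left)
      (intro sum.cong refl *[where g = "\<lambda>C q C'.
        of_bool (of_bool (x _ \<in> C) + of_bool (q \<in> C') = k) * region_length C"], simp)
next
  case False
  then show ?thesis using total_length_coincident[OF assms(2)] by simp
qed

section \<open>Integration over the circle and rotation invariance\<close>

lemma space_circle_borel [simp]: "space circle_borel = sphere 0 1"
  unfolding circle_borel_def by (simp add: space_restrict_space)

lemma space_uniform_circle [simp]: "space uniform_circle = sphere 0 1"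
  unfolding uniform_circle_def by simp

lemma sets_uniform_circle [measurable_cong, simp]: "sets uniform_circle = sets circle_borel"
  unfolding uniform_circle_def by simp

lemma circle_borel_imp_borel [measurable (raw)]:
  assumes "f \<in> M \<rightarrow>\<^sub>M circle_borel" shows "f \<in> M \<rightarrow>\<^sub>M borel"
proof -
  have "(\<lambda>z. z) \<in> circle_borel \<rightarrow>\<^sub>M borel"
    unfolding circle_borel_def by (intro measurable_restrict_space1) simp
  then show ?thesis using measurable_compose[OF assms] by blast
qed

lemma measurable_circle_borelI:
  assumes "f \<in> M \<rightarrow>\<^sub>M borel" "\<And>x. x \<in> space M \<Longrightarrow> norm (f x) = 1"
  shows "f \<in> M \<rightarrow>\<^sub>M circle_borel"
  using assms unfolding circle_borel_def by (intro measurable_restrict_space2) auto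

lemma cis_measurable [measurable]: "(\<lambda>t. cis (2 * pi * t)) \<in> borel \<rightarrow>\<^sub>M circle_borel"
proof (rule measurable_circle_borelI)
  show "(\<lambda>t. cis (2 * pi * t)) \<in> borel_measurable borel"
    by (intro borel_measurable_continuous_onI continuous_intros)
qed auto

lemma prob_space_uniform_circle: "prob_space uniform_circle"
proof -
  have "prob_space (uniform_measure lborel {0..<1::real})"
    by (rule prob_space_uniform_measure) auto
  then show ?thesis unfolding uniform_circle_def
    by (rule prob_space.prob_space_distr) simp
qed

lemma nn_integral_uniform_circle:
  assumes "f \<in> borel_measurable circle_borel"
  shows "(\<integral>\<^sup>+ w. f w \<partial>uniform_circle) = (\<integral>\<^sup>+ t. f (cis (2 * pi * t)) * indicator {0..<1} t \<partial>lborel)"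
proof -
  have "(\<integral>\<^sup>+ w. f w \<partial>uniform_circle) = (\<integral>\<^sup>+ t. f (cis (2 * pi * t)) \<partial>uniform_measure lborel {0..<1})"
    unfolding uniform_circle_def using assms by (intro nn_integral_distr) auto
  also have "\<dots> = (\<integral>\<^sup>+ t. f (cis (2 * pi * t)) * indicator {0..<1} t \<partial>lborel) / emeasure lborel {0..<1::real}"
    using assms by (intro nn_integral_uniform_measure) auto
  finally show ?thesis by (simp add: divide_ennreal_def)
qed

text \<open>The part of the window beyond 1 is moved back by one period and fills the missing
  initial piece.\<close>

lemma nn_integral_periodic:
  fixes g :: "real \<Rightarrow> ennreal"
  assumes [measurable]: "g \<in> borel_measurable borel" and per: "\<And>t. g (t + 1) = g t" and "0 \<le> a" "a \<le> 1"
  shows "(\<integral>\<^sup>+ t. g t * indicator {a..<a+1} t \<partial>lborel) = (\<integral>\<^sup>+ t. g t * indicator {0..<1} t \<partial>lborel)"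
proof -
  have "(\<integral>\<^sup>+ t. g t * indicator {1..<a+1} t \<partial>lborel)
      = (\<integral>\<^sup>+ t. g (1 + 1 * t) * indicator {1..<a+1} (1 + 1 * t) \<partial>lborel)"
    by (subst nn_integral_real_affine[where c = 1 and t = 1]) auto
  also have "\<dots> = (\<integral>\<^sup>+ t. g t * indicator {0..<a} t \<partial>lborel)"
  proof (intro nn_integral_cong)
    fix t :: real
    have "g (1 + t) = g t" using per[of t] by (simp add: add.commute)
    then show "g (1 + 1 * t) * indicator {1..<a+1} (1 + 1 * t) = g t * indicator {0..<a} t"
      by (simp add: indicator_def)
  qed
  finally have shift: "(\<integral>\<^sup>+ t. g t * indicator {1..<a+1} t \<partial>lborel) = (\<integral>\<^sup>+ t. g t * indicator {0..<a} t \<partial>lborel)" .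
  have "(\<integral>\<^sup>+ t. g t * indicator {a..<a+1} t \<partial>lborel)
      = (\<integral>\<^sup>+ t. g t * indicator {a..<1} t + g t * indicator {1..<a+1} t \<partial>lborel)"
    using assms by (intro nn_integral_cong) (auto simp: indicator_def)
  also have "\<dots> = (\<integral>\<^sup>+ t. g t * indicator {a..<1} t + g t * indicator {0..<a} t \<partial>lborel)"
    by (simp add: nn_integral_add shift)
  also have "\<dots> = (\<integral>\<^sup>+ t. g t * indicator {0..<1} t \<partial>lborel)"
    using assms by (intro nn_integral_cong) (auto simp: indicator_def)
  finally show ?thesis .
qed

text \<open>In the angle parameter a rotation is a translation, which merely shifts the window of
  length one period.\<close>

lemma nn_integral_uniform_circle_rotate:
  assumes [measurable]: "f \<in> borel_measurable circle_borel" and "norm c = 1"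
  shows "(\<integral>\<^sup>+ w. f (c * w) \<partial>uniform_circle) = (\<integral>\<^sup>+ w. f w \<partial>uniform_circle)"
proof -
  define a where "a = Arg2pi c / (2 * pi)"
  have a: "0 \<le> a" "a \<le> 1" using Arg2pi[of c] unfolding a_def by (auto simp: divide_le_eq_1)
  have c: "c = cis (2 * pi * a)" using Arg2pi_eq[of c] assms(2) unfolding a_def by (simp add: cis_conv_exp)
  have rot: "(\<lambda>w. c * w) \<in> circle_borel \<rightarrow>\<^sub>M circle_borel"
    using assms(2) by (intro measurable_circle_borelI) (auto simp: norm_mult)
  have per: "f (cis (2 * pi * (t + 1))) = f (cis (2 * pi * t))" for t
    by (simp add: distrib_left flip: cis_mult)
  have "(\<integral>\<^sup>+ w. f (c * w) \<partial>uniform_circle)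
      = (\<integral>\<^sup>+ t. f (cis (2 * pi * (a + 1 * t))) * indicator {0..<1} t \<partial>lborel)"
    using measurable_compose[OF rot assms(1)]
    by (subst nn_integral_uniform_circle) (simp_all add: c cis_mult distrib_left)
  also have "\<dots> = (\<integral>\<^sup>+ t. f (cis (2 * pi * (a + 1 * t))) * indicator {a..<a+1} (a + 1 * t) \<partial>lborel)"
    by (intro nn_integral_cong) (auto simp: indicator_def)
  also have "\<dots> = (\<integral>\<^sup>+ t. f (cis (2 * pi * t)) * indicator {a..<a+1} t \<partial>lborel)"
    by (subst (2) nn_integral_real_affine[where c = 1 and t = a]) auto
  also have "\<dots> = (\<integral>\<^sup>+ t. f (cis (2 * pi * t)) * indicator {0..<1} t \<partial>lborel)"
    using a per by (intro nn_integral_periodic) auto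
  finally show ?thesis by (simp add: nn_integral_uniform_circle)
qed

text \<open>On this window the circle distance to the point 1 is simply the absolute value of the
  parameter.\<close>

lemma nn_integral_uniform_circle_sym:
  assumes [measurable]: "f \<in> borel_measurable circle_borel"
  shows "(\<integral>\<^sup>+ w. f w \<partial>uniform_circle) = (\<integral>\<^sup>+ t. f (cis (2 * pi * t)) * indicator {-1/2..<1/2} t \<partial>lborel)"
proof -
  have per: "f (cis (2 * pi * (t + 1))) = f (cis (2 * pi * t))" for t
    by (simp add: distrib_left flip: cis_mult)
  have "(\<integral>\<^sup>+ t. f (cis (2 * pi * t)) * indicator {-1/2..<1/2} t \<partial>lborel)
     = (\<integral>\<^sup>+ t. f (cis (2 * pi * (-1 + 1 * t))) * indicator {-1/2..<1/2} (-1 + 1 * t) \<partial>lborel)"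
    by (subst nn_integral_real_affine[where c = 1 and t = "-1"]) auto
  also have "\<dots> = (\<integral>\<^sup>+ t. f (cis (2 * pi * t)) * indicator {1/2..<1/2+1} t \<partial>lborel)"
  proof (intro nn_integral_cong)
    fix t :: real
    show "f (cis (2 * pi * (-1 + 1 * t))) * indicator {-1/2..<1/2} (-1 + 1 * t)
      = f (cis (2 * pi * t)) * indicator {1/2..<1/2+1} t"
      using per[of "t - 1"] by (auto simp: indicator_def)
  qed
  also have "\<dots> = (\<integral>\<^sup>+ t. f (cis (2 * pi * t)) * indicator {0..<1} t \<partial>lborel)"
    using per by (intro nn_integral_periodic) auto
  finally show ?thesis by (simp add: nn_integral_uniform_circle)
qed

lemma emeasure_uniform_circle_sym:
  assumes "S \<in> sets circle_borel"
  shows "emeasure uniform_circle S = emeasure lborel {t. -1/2 \<le> t \<and> t < 1/2 \<and> cis (2 * pi * t) \<in> S}"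
proof -
  define T where "T = {t. -1/2 \<le> t \<and> t < 1/2 \<and> cis (2 * pi * t) \<in> S}"
  have [measurable]: "T \<in> sets borel"
    using assms unfolding T_def by measurable
  have "emeasure uniform_circle S = (\<integral>\<^sup>+ w. indicator S w \<partial>uniform_circle)"
    using assms by simp
  also have "\<dots> = (\<integral>\<^sup>+ t. indicator S (cis (2 * pi * t)) * indicator {-1/2..<1/2} t \<partial>lborel)"
    using assms by (intro nn_integral_uniform_circle_sym) simp
  also have "\<dots> = (\<integral>\<^sup>+ t. indicator T t \<partial>lborel)"
    by (intro nn_integral_cong) (auto simp: indicator_def T_def)
  finally show ?thesis unfolding T_def[symmetric] by simp
qed

lemma emeasure_uniform_circle_rotate:
  assumes S: "S \<in> sets circle_borel" and T: "T \<in> sets circle_borel" and "norm c = 1"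
    and "\<And>w. w \<in> sphere 0 1 \<Longrightarrow> c * w \<in> S \<longleftrightarrow> w \<in> T"
  shows "emeasure uniform_circle S = emeasure uniform_circle T"
proof -
  have "emeasure uniform_circle S = (\<integral>\<^sup>+ w. indicator S (c * w) \<partial>uniform_circle)"
    using assms by (subst nn_integral_uniform_circle_rotate) auto
  also have "\<dots> = (\<integral>\<^sup>+ w. indicator T w \<partial>uniform_circle)"
    using assms by (intro nn_integral_cong) (auto simp: indicator_def)
  finally show ?thesis using T by simp
qed

lemma region_length_eq_measure:
  assumes "R \<in> sets borel"
  shows "region_length R = measure uniform_circle {w \<in> sphere 0 1. w \<in> R}"
proof -
  define W where "W = {w \<in> sphere 0 1. w \<in> R}"
  define T where "T = {t \<in> {0..<1}. cis (2 * pi * t) \<in> R}"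
  have [measurable]: "W \<in> sets circle_borel"
    using assms unfolding circle_borel_def W_def
    by (auto simp: sets_restrict_space Int_def image_iff conj_commute)
  have [measurable]: "T \<in> sets borel" using assms unfolding T_def by measurable
  have "emeasure uniform_circle W = (\<integral>\<^sup>+ w. indicator W w \<partial>uniform_circle)"
    by simp
  also have "\<dots> = (\<integral>\<^sup>+ t. indicator W (cis (2 * pi * t)) * indicator {0..<1} t \<partial>lborel)"
    by (intro nn_integral_uniform_circle) simp
  also have "\<dots> = (\<integral>\<^sup>+ t. indicator T t \<partial>lborel)"
    by (intro nn_integral_cong) (auto simp: indicator_def W_def T_def)
  finally show ?thesis unfolding region_length_def W_def[symmetric] T_def[symmetric] measure_def by simp
qed

section \<open>Double integrals of powers of piecewise linear functions\<close>

text \<open>The condition \<open>Q\<close> is fixed only up to the two endpoints, a null set, so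
  that open, half-open and implicitly described intervals all fit. The slope may have either sign;
  nonnegativity at the endpoints extends to the interval by linearity.\<close>

lemma nn_integral_power_linear:
  fixes a b c d K :: real
  assumes "a \<le> b" "d \<noteq> 0" "K \<ge> 0" and nn: "c + d * a \<ge> 0" "c + d * b \<ge> 0"
    and Q: "\<And>x. a < x \<Longrightarrow> x < b \<Longrightarrow> Q x" "\<And>x. Q x \<Longrightarrow> a \<le> x \<and> x \<le> b"
  shows "(\<integral>\<^sup>+ x. (if Q x then ennreal (K * (c + d * x) ^ m) else 0) \<partial>lborel)
    = ennreal (K * ((c + d * b) ^ Suc m - (c + d * a) ^ Suc m) / (d * real (Suc m)))"
proof -
  have pos: "c + d * x \<ge> 0" if "a \<le> x" "x \<le> b" for x
  proof (cases "d > 0")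
    case True
    then have "d * a \<le> d * x" using that by simp
    then show ?thesis using nn by simp
  next
    case False
    then have "d * b \<le> d * x" using that by (simp add: mult_left_mono_neg)
    then show ?thesis using nn by simp
  qed
  have "(\<integral>\<^sup>+ x. (if Q x then ennreal (K * (c + d * x) ^ m) else 0) \<partial>lborel)
      = (\<integral>\<^sup>+ x. ennreal (K * (c + d * x) ^ m) * indicator {a..b} x \<partial>lborel)"
  proof (rule nn_integral_cong_AE)
    have "AE x in lborel. x \<noteq> a \<and> x \<noteq> b"
      by (intro AE_conjI AE_lborel_singleton)
    then show "AE x in lborel. (if Q x then ennreal (K * (c + d * x) ^ m) else 0)
        = ennreal (K * (c + d * x) ^ m) * indicator {a..b} x"
      by eventually_elim (use Q in \<open>auto simp: indicator_def less_le\<close>)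
  qed
  also have "\<dots> = ennreal (K * (c + d * b) ^ Suc m / (d * real (Suc m)) - K * (c + d * a) ^ Suc m / (d * real (Suc m)))"
  proof (rule nn_integral_FTC_Icc[where F = "\<lambda>x. K * (c + d * x) ^ Suc m / (d * real (Suc m))"])
    fix x assume "x \<in> {a..b}"
    then have x: "a \<le> x" "x \<le> b" by auto
    show "((\<lambda>x. K * (c + d * x) ^ Suc m / (d * real (Suc m))) has_real_derivative K * (c + d * x) ^ m) (at x)"
    proof -
      have "((\<lambda>x. c + d * x) has_real_derivative d) (at x)"
        by (auto intro!: derivative_eq_intros)
      from DERIV_cdivide[OF DERIV_cmult[OF DERIV_power_Suc[OF this]], of K m "d * real (Suc m)"]
      have "((\<lambda>x. K * (c + d * x) ^ Suc m / (d * real (Suc m))) has_real_derivative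
        K * ((1 + real m) * (d * (c + d * x) ^ m)) / (d * real (Suc m))) (at x)" by simp
      also have "K * ((1 + real m) * (d * (c + d * x) ^ m)) / (d * real (Suc m)) = K * (c + d * x) ^ m"
        using \<open>d \<noteq> 0\<close> by simp
      finally show ?thesis .
    qed
    show "0 \<le> K * (c + d * x) ^ m" using pos[OF x] \<open>K \<ge> 0\<close> by simp
  qed (use assms in auto)
  finally show ?thesis by (simp add: right_diff_distrib diff_divide_distrib)
qed

text \<open>The shape of most outer integrals below: the inner integral leaves a power of a linear
  function that is 1 at 0 and vanishes where the sector ends.\<close>

lemma nn_integral_unit_power:
  fixes d K :: real
  assumes "d > 0" "K \<ge> 0"
  shows "(\<integral>\<^sup>+ y. (if 0 < y \<and> y < 1/d then ennreal (K * (1 + (-d) * y) ^ Suc m) else 0) \<partial>lborel)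
    = ennreal (K / (d * (real m + 2)))"
proof -
  have "(\<integral>\<^sup>+ y. (if 0 < y \<and> y < 1/d then ennreal (K * (1 + (-d) * y) ^ Suc m) else 0) \<partial>lborel)
    = ennreal (K * ((1 + (-d) * (1/d)) ^ Suc (Suc m) - (1 + (-d) * 0) ^ Suc (Suc m)) / ((-d) * real (Suc (Suc m))))"
    using assms by (intro nn_integral_power_linear) auto
  also have "K * ((1 + (-d) * (1/d)) ^ Suc (Suc m) - (1 + (-d) * 0) ^ Suc (Suc m)) / ((-d) * real (Suc (Suc m)))
    = K / (d * (real m + 2))"
  proof -
    have "1 + (-d) * (1/d) = 0" "real (Suc (Suc m)) = real m + 2" using assms by simp_all
    then show ?thesis by (simp only: power_0_Suc mult_zero_right add_0_right power_one) simp
  qed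
  finally show ?thesis .
qed

lemma nn_integral_if_disjoint:
  assumes [measurable]: "f \<in> borel_measurable M" "g \<in> borel_measurable M" "Measurable.pred M P" "Measurable.pred M Q"
    and eq: "\<And>x. R x \<longleftrightarrow> P x \<or> Q x" "\<And>x. P x \<Longrightarrow> h x = f x" "\<And>x. Q x \<Longrightarrow> h x = g x"
    and disj: "\<And>x. \<not> (P x \<and> Q x)"
  shows "(\<integral>\<^sup>+ x. (if R x then h x else 0) \<partial>M)
    = (\<integral>\<^sup>+ x. (if P x then f x else 0) \<partial>M) + (\<integral>\<^sup>+ x. (if Q x then g x else 0) \<partial>M)"
proof -
  have "(\<integral>\<^sup>+ x. (if R x then h x else 0) \<partial>M)
    = (\<integral>\<^sup>+ x. (if P x then f x else 0) + (if Q x then g x else 0) \<partial>M)"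
    using eq disj by (intro nn_integral_cong) auto
  then show ?thesis by (simp add: nn_integral_add)
qed

text \<open>The plane without the null set \<open>y = 0\<close>, \<open>x = 0\<close>, \<open>x = y\<close> consists of the three sectors below
  and their reflections in the origin.\<close>

lemma nn_integral_sectors:
  fixes G :: "real \<Rightarrow> real \<Rightarrow> ennreal"
  assumes [measurable]: "(\<lambda>(x, y). G x y) \<in> borel_measurable (borel \<Otimes>\<^sub>M borel)"
    and sym: "\<And>x y. G (- x) (- y) = G x y"
  shows "(\<integral>\<^sup>+ y. \<integral>\<^sup>+ x. G x y \<partial>lborel \<partial>lborel) = 2 *
     ((\<integral>\<^sup>+ y. \<integral>\<^sup>+ x. (if x < 0 \<and> 0 < y then G x y else 0) \<partial>lborel \<partial>lborel)
    + (\<integral>\<^sup>+ y. \<integral>\<^sup>+ x. (if 0 < x \<and> x < y then G x y else 0) \<partial>lborel \<partial>lborel)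
    + (\<integral>\<^sup>+ y. \<integral>\<^sup>+ x. (if 0 < y \<and> y < x then G x y else 0) \<partial>lborel \<partial>lborel))"
proof -
  define h where "h y = (\<integral>\<^sup>+ x. G x y \<partial>lborel)" for y
  have [measurable]: "h \<in> borel_measurable borel" unfolding h_def by measurable
  have even: "h (- y) = h y" for y
  proof -
    have "h (- y) = (\<integral>\<^sup>+ x. G (0 + (-1) * x) (- y) \<partial>lborel)"
      unfolding h_def by (subst nn_integral_real_affine[where c = "-1" and t = 0]) auto
    then show ?thesis unfolding h_def using sym by simp
  qed
  have "(\<integral>\<^sup>+ y. h y \<partial>lborel) = (\<integral>\<^sup>+ y. (if y > 0 then h y else 0) + (if y < 0 then h y else 0) \<partial>lborel)"
  proof (rule nn_integral_cong_AE)
    show "AE y in lborel. h y = (if y > 0 then h y else 0) + (if y < 0 then h y else 0)"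
      using AE_lborel_singleton[of "0::real"] by eventually_elim auto
  qed
  also have "\<dots> = (\<integral>\<^sup>+ y. (if y > 0 then h y else 0) \<partial>lborel) + (\<integral>\<^sup>+ y. (if y < 0 then h y else 0) \<partial>lborel)"
    by (simp add: nn_integral_add)
  also have "(\<integral>\<^sup>+ y. (if y < 0 then h y else 0) \<partial>lborel)
      = (\<integral>\<^sup>+ y. (if 0 + (-1) * y < 0 then h (0 + (-1) * y) else 0) \<partial>lborel)"
    by (subst nn_integral_real_affine[where c = "-1" and t = 0]) auto
  also have "\<dots> = (\<integral>\<^sup>+ y. (if y > 0 then h y else 0) \<partial>lborel)"
    using even by (intro nn_integral_cong) auto
  finally have twice: "(\<integral>\<^sup>+ y. h y \<partial>lborel) = 2 * (\<integral>\<^sup>+ y. (if y > 0 then h y else 0) \<partial>lborel)"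
    by (simp add: mult_2)
  have "(if y > 0 then h y else 0) = (\<integral>\<^sup>+ x. (if x < 0 \<and> 0 < y then G x y else 0) \<partial>lborel)
    + (\<integral>\<^sup>+ x. (if 0 < x \<and> x < y then G x y else 0) \<partial>lborel)
    + (\<integral>\<^sup>+ x. (if 0 < y \<and> y < x then G x y else 0) \<partial>lborel)" for y
  proof (cases "y > 0")
    case True
    have "h y = (\<integral>\<^sup>+ x. (if x < 0 \<and> 0 < y then G x y else 0) + (if 0 < x \<and> x < y then G x y else 0)
       + (if 0 < y \<and> y < x then G x y else 0) \<partial>lborel)"
      unfolding h_def
    proof (rule nn_integral_cong_AE)
      have "AE x in lborel. x \<noteq> 0 \<and> x \<noteq> y" by (intro AE_conjI AE_lborel_singleton)
      then show "AE x in lborel. G x y = (if x < 0 \<and> 0 < y then G x y else 0)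
          + (if 0 < x \<and> x < y then G x y else 0) + (if 0 < y \<and> y < x then G x y else 0)"
        by eventually_elim (use True in auto)
    qed
    then show ?thesis using True by (simp add: nn_integral_add)
  next
    case False
    then have *: "\<not> (x < 0 \<and> 0 < y)" "\<not> (0 < x \<and> x < y)" "\<not> (0 < y \<and> y < x)" for x by auto
    have "(\<lambda>x. if x < 0 \<and> 0 < y then G x y else 0) = (\<lambda>x. 0)"
      "(\<lambda>x. if 0 < x \<and> x < y then G x y else 0) = (\<lambda>x. 0)"
      "(\<lambda>x. if 0 < y \<and> y < x then G x y else 0) = (\<lambda>x. 0)"
      by (simp_all only: * if_False)
    then show ?thesis using False by simp
  qed
  then show ?thesis unfolding h_def[symmetric] twice
    by (simp add: nn_integral_add)
qed

text \<open>Tonelli with the names of the variables exchanged. It brings the sector above the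
  diagonal to the one below it, so that one computation can serve both.\<close>

lemma nn_integral_swap_sector:
  fixes G :: "real \<Rightarrow> real \<Rightarrow> ennreal"
  assumes [measurable]: "(\<lambda>(x, y). G x y) \<in> borel_measurable (borel \<Otimes>\<^sub>M borel)"
  shows "(\<integral>\<^sup>+ y. \<integral>\<^sup>+ x. (if 0 < x \<and> x < y then G x y else 0) \<partial>lborel \<partial>lborel)
    = (\<integral>\<^sup>+ y. \<integral>\<^sup>+ x. (if 0 < y \<and> y < x then G y x else 0) \<partial>lborel \<partial>lborel)"
  by (intro lborel_pair.Fubini') measurable

text \<open>The inner integral over a linear function falling with slope 4 to a third of its initial
  value and then with slope 1 to 0; \<open>p\<close> is the initial value to the power
  \<open>Suc m\<close>. With \<open>r = (1/3) ^ Suc m\<close> the sum rests on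
  \<open>(1 - r) + 4 * r = 1 + 3 * r\<close>.\<close>

lemma third_power_sum:
  assumes "p \<ge> 0"
  shows "ennreal (p * (1 - (1/3) ^ Suc m) / (4 * real (Suc m))) + ennreal ((1/3) ^ Suc m * p / real (Suc m))
    = ennreal ((1 + (1/3) ^ m) / (4 * (real m + 1)) * p)"
proof -
  define q M where "q = (1/3::real) ^ m" and "M = real (Suc m)"
  have q: "0 \<le> q" "q \<le> 1" "(1/3::real) ^ Suc m = q / 3" unfolding q_def by (auto intro: power_le_one)
  have M: "M > 0" "real m + 1 = M" unfolding M_def by auto
  have "p * (1 - q / 3) / (4 * M) + q / 3 * p / M = (1 + q) / (4 * M) * p"
    using M(1) by (simp add: divide_simps) (simp add: algebra_simps)
  moreover have "ennreal (p * (1 - q / 3) / (4 * M)) + ennreal (q / 3 * p / M)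
      = ennreal (p * (1 - q / 3) / (4 * M) + q / 3 * p / M)"
    using assms q M by (intro ennreal_plus[symmetric]) auto
  ultimately show ?thesis unfolding q(3) M q_def[symmetric] M_def[symmetric] by simp
qed

text \<open>Shared by the integrals with one and with both conditions, whose integrands agree in
  this sector. The linear pieces cross at \<open>x = (1/2 + y) / 3\<close>, where both equal a third
  of the value \<open>1 - 4 * y\<close> taken at \<open>x = y\<close>.\<close>

lemma sector_AB_right:
  fixes m :: nat
  shows "(\<integral>\<^sup>+ y. \<integral>\<^sup>+ x. (if 0 < y \<and> y < x then
      if \<bar>x\<bar> + \<bar>y\<bar> < 1/2 then ennreal ((max (1 - 4 * x) (1/2 - x - y)) ^ m) else 0 else 0) \<partial>lborel \<partial>lborel)
    = ennreal ((1 + (1/3) ^ m) / (16 * (real m + 1) * (real m + 2)))"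
proof -
  have inner: "(\<integral>\<^sup>+ x. (if 0 < y \<and> y < x then
      if \<bar>x\<bar> + \<bar>y\<bar> < 1/2 then ennreal ((max (1 - 4 * x) (1/2 - x - y)) ^ m) else 0 else 0) \<partial>lborel)
    = (if 0 < y \<and> y < 1/4 then ennreal ((1 + (1/3) ^ m) / (4 * (real m + 1)) * (1 + (-4) * y) ^ Suc m) else 0)"
    (is "?I = _") for y :: real
  proof (cases "0 < y \<and> y < 1/4")
    case True
    have "?I = (\<integral>\<^sup>+ x. (if 0 < y \<and> y < x \<and> \<bar>x\<bar> + \<bar>y\<bar> < 1/2 then ennreal ((max (1 - 4 * x) (1/2 - x - y)) ^ m) else 0) \<partial>lborel)"
      by (intro nn_integral_cong) auto
    also have "\<dots> = (\<integral>\<^sup>+ x. (if y < x \<and> x < (1/2 + y) / 3 then ennreal (1 * (1 + (-4) * x) ^ m) else 0) \<partial>lborel)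
      + (\<integral>\<^sup>+ x. (if (1/2 + y) / 3 \<le> x \<and> x < 1/2 - y then ennreal (1 * (1/2 - y + (-1) * x) ^ m) else 0) \<partial>lborel)"
      using True by (intro nn_integral_if_disjoint) (auto simp: max_def field_simps)
    also have "(\<integral>\<^sup>+ x. (if y < x \<and> x < (1/2 + y) / 3 then ennreal (1 * (1 + (-4) * x) ^ m) else 0) \<partial>lborel)
       = ennreal (1 * ((1 + (-4) * ((1/2 + y) / 3)) ^ Suc m - (1 + (-4) * y) ^ Suc m) / (-4 * real (Suc m)))"
      using True by (intro nn_integral_power_linear) (auto simp: field_simps)
    also have "(\<integral>\<^sup>+ x. (if (1/2 + y) / 3 \<le> x \<and> x < 1/2 - y then ennreal (1 * (1/2 - y + (-1) * x) ^ m) else 0) \<partial>lborel)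
       = ennreal (1 * ((1/2 - y + (-1) * (1/2 - y)) ^ Suc m - (1/2 - y + (-1) * ((1/2 + y) / 3)) ^ Suc m) / (-1 * real (Suc m)))"
      using True by (intro nn_integral_power_linear) (auto simp: field_simps)
    also have "1 + (-4) * ((1/2 + y) / 3) = (1/3) * (1 + (-4) * y)" by (simp add: field_simps)
    also have "1/2 - y + (-1) * ((1/2 + y) / 3) = (1/3) * (1 + (-4) * y)" by (simp add: field_simps)
    finally have I: "?I = ennreal (1 * ((1/3 * (1 + (-4) * y)) ^ Suc m - (1 + (-4) * y) ^ Suc m) / (-4 * real (Suc m)))
      + ennreal (1 * ((1/2 - y + (-1) * (1/2 - y)) ^ Suc m - (1/3 * (1 + (-4) * y)) ^ Suc m) / (-1 * real (Suc m)))" .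
    define p where "p = (1 + (-4) * y) ^ Suc m"
    have p: "p \<ge> 0" unfolding p_def using True by (intro zero_le_power) simp
    have e: "(1/3 * (1 + (-4) * y)) ^ Suc m = (1/3) ^ Suc m * p" unfolding p_def by (rule power_mult_distrib)
    have z: "(1/2 - y + (-1) * (1/2 - y)) ^ Suc m = 0" by simp
    have "1 * (q * p - p) / (-4 * M) = p * (1 - q) / (4 * M)" "1 * (0 - q * p) / (-1 * M) = q * p / M" for q M :: real
      by (simp_all add: algebra_simps diff_divide_distrib)
    then show ?thesis
      using True unfolding I e z p_def[symmetric] by (simp only: third_power_sum[OF p] if_True simp_thms)
  next
    case False
    then have "?I = integral\<^sup>N lborel (\<lambda>x::real. 0)" by (intro nn_integral_cong) auto
    then show ?thesis unfolding if_not_P[OF False] by simp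
  qed
  show ?thesis
    unfolding inner
    by (subst nn_integral_unit_power[where d = 4]) (simp_all add: field_simps)
qed

text \<open>The pieces cross at \<open>x = (2 * y - 1) / 6\<close>, where both equal a third of the
  value \<open>1 - 2 * y\<close> taken at \<open>x = 0\<close>.\<close>

lemma sector_A_left:
  fixes m :: nat
  shows "(\<integral>\<^sup>+ y. \<integral>\<^sup>+ x. (if x < 0 \<and> 0 < y then
      if \<bar>x\<bar> + \<bar>y\<bar> < 1/2 then ennreal ((max (1 - 2 * y + 4 * x) (1/2 - y + x)) ^ m) else 0 else 0) \<partial>lborel \<partial>lborel)
    = ennreal ((1 + (1/3) ^ m) / (8 * (real m + 1) * (real m + 2)))"
proof -
  have inner: "(\<integral>\<^sup>+ x. (if x < 0 \<and> 0 < y then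
      if \<bar>x\<bar> + \<bar>y\<bar> < 1/2 then ennreal ((max (1 - 2 * y + 4 * x) (1/2 - y + x)) ^ m) else 0 else 0) \<partial>lborel)
    = (if 0 < y \<and> y < 1/2 then ennreal ((1 + (1/3) ^ m) / (4 * (real m + 1)) * (1 + (-2) * y) ^ Suc m) else 0)"
    (is "?I = _") for y :: real
  proof (cases "0 < y \<and> y < 1/2")
    case True
    have "?I = (\<integral>\<^sup>+ x. (if x < 0 \<and> 0 < y \<and> \<bar>x\<bar> + \<bar>y\<bar> < 1/2 then ennreal ((max (1 - 2 * y + 4 * x) (1/2 - y + x)) ^ m) else 0) \<partial>lborel)"
      by (intro nn_integral_cong) auto
    also have "\<dots> = (\<integral>\<^sup>+ x. (if (2 * y - 1) / 6 < x \<and> x < 0 then ennreal (1 * (1 - 2 * y + 4 * x) ^ m) else 0) \<partial>lborel)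
      + (\<integral>\<^sup>+ x. (if y - 1/2 < x \<and> x \<le> (2 * y - 1) / 6 then ennreal (1 * (1/2 - y + 1 * x) ^ m) else 0) \<partial>lborel)"
      using True by (intro nn_integral_if_disjoint) (auto simp: max_def field_simps)
    also have "(\<integral>\<^sup>+ x. (if (2 * y - 1) / 6 < x \<and> x < 0 then ennreal (1 * (1 - 2 * y + 4 * x) ^ m) else 0) \<partial>lborel)
       = ennreal (1 * ((1 - 2 * y + 4 * 0) ^ Suc m - (1 - 2 * y + 4 * ((2 * y - 1) / 6)) ^ Suc m) / (4 * real (Suc m)))"
      using True by (intro nn_integral_power_linear) (auto simp: field_simps)
    also have "(\<integral>\<^sup>+ x. (if y - 1/2 < x \<and> x \<le> (2 * y - 1) / 6 then ennreal (1 * (1/2 - y + 1 * x) ^ m) else 0) \<partial>lborel)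
       = ennreal (1 * ((1/2 - y + 1 * ((2 * y - 1) / 6)) ^ Suc m - (1/2 - y + 1 * (y - 1/2)) ^ Suc m) / (1 * real (Suc m)))"
      using True by (intro nn_integral_power_linear) (auto simp: field_simps)
    also have "1 - 2 * y + 4 * 0 = 1 + (-2) * y" by simp
    also have "1 - 2 * y + 4 * ((2 * y - 1) / 6) = (1/3) * (1 + (-2) * y)" by (simp add: field_simps)
    also have "1/2 - y + 1 * ((2 * y - 1) / 6) = (1/3) * (1 + (-2) * y)" by (simp add: field_simps)
    finally have I: "?I = ennreal (1 * ((1 + (-2) * y) ^ Suc m - (1/3 * (1 + (-2) * y)) ^ Suc m) / (4 * real (Suc m)))
      + ennreal (1 * ((1/3 * (1 + (-2) * y)) ^ Suc m - (1/2 - y + 1 * (y - 1/2)) ^ Suc m) / (1 * real (Suc m)))" .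
    define p where "p = (1 + (-2) * y) ^ Suc m"
    have p: "p \<ge> 0" unfolding p_def using True by (intro zero_le_power) simp
    have e: "(1/3 * (1 + (-2) * y)) ^ Suc m = (1/3) ^ Suc m * p" unfolding p_def by (rule power_mult_distrib)
    have z: "(1/2 - y + 1 * (y - 1/2)) ^ Suc m = 0" by simp
    have "1 * (p - q * p) / (4 * M) = p * (1 - q) / (4 * M)" "1 * (q * p - 0) / (1 * M) = q * p / M" for q M :: real
      by (simp_all add: algebra_simps diff_divide_distrib)
    then show ?thesis
      using True unfolding I e z p_def[symmetric] by (simp only: third_power_sum[OF p] if_True simp_thms)
  next
    case False
    then have "?I = integral\<^sup>N lborel (\<lambda>x::real. 0)" by (intro nn_integral_cong) auto
    then show ?thesis unfolding if_not_P[OF False] by simp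
  qed
  show ?thesis
    unfolding inner
    by (subst nn_integral_unit_power[where d = 2]) (simp_all add: field_simps)
qed

text \<open>Here both arcs persist with equal length, hence one linear piece and no power of
  1/3.\<close>

lemma sector_A_middle:
  fixes m :: nat
  shows "(\<integral>\<^sup>+ y. \<integral>\<^sup>+ x. (if 0 < y \<and> y < x then
      if \<bar>y\<bar> + \<bar>x\<bar> < 1/2 then ennreal ((1 - 2 * x - 2 * y) ^ m) else 0 else 0) \<partial>lborel \<partial>lborel)
    = ennreal (1 / (8 * (real m + 1) * (real m + 2)))"
proof -
  have inner: "(\<integral>\<^sup>+ x. (if 0 < y \<and> y < x then
      if \<bar>y\<bar> + \<bar>x\<bar> < 1/2 then ennreal ((1 - 2 * x - 2 * y) ^ m) else 0 else 0) \<partial>lborel)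
    = (if 0 < y \<and> y < 1/4 then ennreal (1 / (2 * (real m + 1)) * (1 + (-4) * y) ^ Suc m) else 0)"
    (is "?I = _") for y :: real
  proof (cases "0 < y \<and> y < 1/4")
    case True
    have "?I = (\<integral>\<^sup>+ x. (if y < x \<and> x < 1/2 - y then ennreal (1 * (1 - 2 * y + (-2) * x) ^ m) else 0) \<partial>lborel)"
      using True by (intro nn_integral_cong) (auto simp: algebra_simps)
    also have "\<dots> = ennreal (1 * ((1 - 2 * y + (-2) * (1/2 - y)) ^ Suc m - (1 - 2 * y + (-2) * y) ^ Suc m) / ((-2) * real (Suc m)))"
      using True by (intro nn_integral_power_linear) auto
    also have "1 - 2 * y + (-2) * (1/2 - y) = 0" by simp
    also have "1 - 2 * y + (-2) * y = 1 + (-4) * y" by simp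
    finally show ?thesis using True by (simp add: field_simps)
  next
    case False
    then have "?I = integral\<^sup>N lborel (\<lambda>x::real. 0)" by (intro nn_integral_cong) auto
    then show ?thesis unfolding if_not_P[OF False] by simp
  qed
  show ?thesis
    unfolding inner
    by (subst nn_integral_unit_power[where d = 4]) (simp_all add: field_simps)
qed

lemma sector_0_left:
  fixes m :: nat
  shows "(\<integral>\<^sup>+ y. \<integral>\<^sup>+ x. (if x < 0 \<and> 0 < y then
      if \<bar>x\<bar> + \<bar>y\<bar> < 1/2 then ennreal ((1 - 2 * y + 2 * x) ^ m) else 0 else 0) \<partial>lborel \<partial>lborel)
    = ennreal (1 / (4 * (real m + 1) * (real m + 2)))"
proof -
  have inner: "(\<integral>\<^sup>+ x. (if x < 0 \<and> 0 < y then
      if \<bar>x\<bar> + \<bar>y\<bar> < 1/2 then ennreal ((1 - 2 * y + 2 * x) ^ m) else 0 else 0) \<partial>lborel)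
    = (if 0 < y \<and> y < 1/2 then ennreal (1 / (2 * (real m + 1)) * (1 + (-2) * y) ^ Suc m) else 0)"
    (is "?I = _") for y :: real
  proof (cases "0 < y \<and> y < 1/2")
    case True
    have "?I = (\<integral>\<^sup>+ x. (if y - 1/2 < x \<and> x < 0 then ennreal (1 * (1 - 2 * y + 2 * x) ^ m) else 0) \<partial>lborel)"
      using True by (intro nn_integral_cong) (auto simp: algebra_simps)
    also have "\<dots> = ennreal (1 * ((1 - 2 * y + 2 * 0) ^ Suc m - (1 - 2 * y + 2 * (y - 1/2)) ^ Suc m) / (2 * real (Suc m)))"
      using True by (intro nn_integral_power_linear) auto
    also have "1 - 2 * y + 2 * (y - 1/2) = 0" by simp
    also have "1 - 2 * y + 2 * 0 = 1 + (-2) * y" by simp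
    finally show ?thesis using True by (simp add: field_simps)
  next
    case False
    then have "?I = integral\<^sup>N lborel (\<lambda>x::real. 0)" by (intro nn_integral_cong) auto
    then show ?thesis unfolding if_not_P[OF False] by simp
  qed
  show ?thesis
    unfolding inner
    by (subst nn_integral_unit_power[where d = 2]) (simp_all add: field_simps)
qed

text \<open>The integrand depends only on \<open>y - x\<close>, and its pieces meet along the line
  \<open>y - x = 1/6\<close> with value 1/3. As this line is parallel to the outer boundary, the
  break no longer scales with \<open>y\<close>: the inner integral has a constant term, which on
  integration over \<open>y\<close> gains no factor \<open>m + 2\<close> in the denominator. This
  produces the linear factor \<open>2 * m + 9\<close>.\<close>

lemma sector_B_left:
  fixes m :: nat
  shows "(\<integral>\<^sup>+ y. \<integral>\<^sup>+ x. (if x < 0 \<and> 0 < y then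
      if \<bar>x\<bar> + \<bar>y\<bar> < 1/2 then ennreal ((max (1 - 4 * y + 4 * x) (1/2 - y + x)) ^ m) else 0 else 0) \<partial>lborel \<partial>lborel)
    = ennreal ((1 + (1/3) ^ m * (2 * real m + 9) / 3) / (16 * (real m + 1) * (real m + 2)))"
proof -
  define M where "M = real (Suc m)"
  define q where "q = (1/3::real) ^ Suc m"
  have M: "M > 0" "real m + 1 = M" unfolding M_def by auto
  have q: "0 \<le> q" "q \<le> 1" "(1/3::real) ^ m = 3 * q"
    unfolding q_def using power_le_one[of "1/3::real" "Suc m"] by simp_all
  let ?f = "\<lambda>y x :: real. if x < 0 \<and> 0 < y then
      if \<bar>x\<bar> + \<bar>y\<bar> < 1/2 then ennreal ((max (1 - 4 * y + 4 * x) (1/2 - y + x)) ^ m) else 0 else 0"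
  \<comment> \<open>Rows with \<open>y \<le> 1/6\<close> cross the break line, those with larger
    \<open>y\<close> lie beyond it. The constant is \<open>q / M\<close> from the flat piece minus
    \<open>q / (4 * M)\<close> from the lower end of the steep one.\<close>
  have small: "(\<integral>\<^sup>+ x. ?f y x \<partial>lborel) = ennreal (q * 3 / (4 * M)) + ennreal (1 / (4 * M) * (1 + (-4) * y) ^ Suc m)"
    (is "?I = _") if y: "0 < y" "y \<le> 1/6" for y :: real
  proof -
    have "?I = (\<integral>\<^sup>+ x. (if x < 0 \<and> 0 < y \<and> \<bar>x\<bar> + \<bar>y\<bar> < 1/2 then ennreal ((max (1 - 4 * y + 4 * x) (1/2 - y + x)) ^ m) else 0) \<partial>lborel)"
      by (intro nn_integral_cong) auto
    also have "\<dots> = (\<integral>\<^sup>+ x. (if y - 1/6 < x \<and> x < 0 then ennreal (1 * (1 - 4 * y + 4 * x) ^ m) else 0) \<partial>lborel)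
      + (\<integral>\<^sup>+ x. (if y - 1/2 < x \<and> x < 0 \<and> x \<le> y - 1/6 then ennreal (1 * (1/2 - y + 1 * x) ^ m) else 0) \<partial>lborel)"
      using y by (intro nn_integral_if_disjoint) (auto simp: max_def)
    also have "(\<integral>\<^sup>+ x. (if y - 1/6 < x \<and> x < 0 then ennreal (1 * (1 - 4 * y + 4 * x) ^ m) else 0) \<partial>lborel)
       = ennreal (1 * ((1 - 4 * y + 4 * 0) ^ Suc m - (1 - 4 * y + 4 * (y - 1/6)) ^ Suc m) / (4 * real (Suc m)))"
      using y by (intro nn_integral_power_linear) auto
    also have "(\<integral>\<^sup>+ x. (if y - 1/2 < x \<and> x < 0 \<and> x \<le> y - 1/6 then ennreal (1 * (1/2 - y + 1 * x) ^ m) else 0) \<partial>lborel)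
       = ennreal (1 * ((1/2 - y + 1 * (y - 1/6)) ^ Suc m - (1/2 - y + 1 * (y - 1/2)) ^ Suc m) / (1 * real (Suc m)))"
      using y by (intro nn_integral_power_linear) auto
    also have "1 - 4 * y + 4 * 0 = 1 + (-4) * y" by simp
    also have "1 - 4 * y + 4 * (y - 1/6) = 1/3" by simp
    also have "1/2 - y + 1 * (y - 1/6) = 1/3" by simp
    also have "(1/2 - y + 1 * (y - 1/2)) ^ Suc m = 0" by simp
    finally have I: "?I = ennreal (1 * ((1 + (-4) * y) ^ Suc m - q) / (4 * M)) + ennreal (1 * (q - 0) / (1 * M))"
      unfolding q_def M_def .
    have "(1 + (-4) * y) ^ Suc m \<ge> q" unfolding q_def using y by (intro power_mono) auto
    then show ?thesis
      unfolding I using q M by (simp add: field_simps flip: ennreal_plus del: power_Suc)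
  qed
  have large: "(\<integral>\<^sup>+ x. ?f y x \<partial>lborel) = ennreal (1 / M * (1/2 + (-1) * y) ^ Suc m)"
    (is "?I = _") if y: "1/6 < y" "y < 1/2" for y :: real
  proof -
    have "?I = (\<integral>\<^sup>+ x. (if y - 1/2 < x \<and> x < 0 then ennreal (1 * (1/2 - y + 1 * x) ^ m) else 0) \<partial>lborel)"
      using y by (intro nn_integral_cong) (auto simp: max_def)
    also have "\<dots> = ennreal (1 * ((1/2 - y + 1 * 0) ^ Suc m - (1/2 - y + 1 * (y - 1/2)) ^ Suc m) / (1 * real (Suc m)))"
      using y by (intro nn_integral_power_linear) auto
    finally show ?thesis by (simp add: M_def field_simps)
  qed
  \<comment> \<open>The factor \<open>(0 + 1 * y) ^ 0\<close> writes the constant as a power of a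
    linear function, in the form that \<open>nn_integral_power_linear\<close> expects.\<close>
  have "(\<integral>\<^sup>+ x. ?f y x \<partial>lborel) =
      (if 0 < y \<and> y \<le> 1/6 then ennreal (q * 3 / (4 * M) * (0 + 1 * y) ^ 0) else 0)
    + (if 0 < y \<and> y \<le> 1/6 then ennreal (1 / (4 * M) * (1 + (-4) * y) ^ Suc m) else 0)
    + (if 1/6 < y \<and> y < 1/2 then ennreal (1 / M * (1/2 + (-1) * y) ^ Suc m) else 0)" (is "?I = _") for y
  proof -
    consider "0 < y" "y \<le> 1/6" | "1/6 < y" "y < 1/2" | "\<not> (0 < y \<and> y < 1/2)" by linarith
    then show ?thesis
    proof cases
      case 1 then show ?thesis using small by simp
    next
      case 2 then show ?thesis using large by simp
    next
      case 3
      then have "?I = integral\<^sup>N lborel (\<lambda>x::real. 0)" by (intro nn_integral_cong) auto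
      then show ?thesis using 3 by auto
    qed
  qed
  then have "(\<integral>\<^sup>+ y. \<integral>\<^sup>+ x. ?f y x \<partial>lborel \<partial>lborel) =
      (\<integral>\<^sup>+ y. (if 0 < y \<and> y \<le> 1/6 then ennreal (q * 3 / (4 * M) * (0 + 1 * y) ^ 0) else 0) \<partial>lborel)
    + (\<integral>\<^sup>+ y. (if 0 < y \<and> y \<le> 1/6 then ennreal (1 / (4 * M) * (1 + (-4) * y) ^ Suc m) else 0) \<partial>lborel)
    + (\<integral>\<^sup>+ y. (if 1/6 < y \<and> y < 1/2 then ennreal (1 / M * (1/2 + (-1) * y) ^ Suc m) else 0) \<partial>lborel)"
    by (simp only:) (simp add: nn_integral_add)
  also have "(\<integral>\<^sup>+ y. (if 0 < y \<and> y \<le> 1/6 then ennreal (q * 3 / (4 * M) * (0 + 1 * y) ^ 0) else 0) \<partial>lborel)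
    = ennreal (q * 3 / (4 * M) * ((0 + 1 * (1/6)) ^ Suc 0 - (0 + 1 * 0) ^ Suc 0) / (1 * real (Suc 0)))"
    using q M by (intro nn_integral_power_linear) auto
  also have "(\<integral>\<^sup>+ y. (if 0 < y \<and> y \<le> 1/6 then ennreal (1 / (4 * M) * (1 + (-4) * y) ^ Suc m) else 0) \<partial>lborel)
    = ennreal (1 / (4 * M) * ((1 + (-4) * (1/6)) ^ Suc (Suc m) - (1 + (-4) * 0) ^ Suc (Suc m)) / ((-4) * real (Suc (Suc m))))"
    using q M by (intro nn_integral_power_linear) auto
  also have "(\<integral>\<^sup>+ y. (if 1/6 < y \<and> y < 1/2 then ennreal (1 / M * (1/2 + (-1) * y) ^ Suc m) else 0) \<partial>lborel)
    = ennreal (1 / M * ((1/2 + (-1) * (1/2)) ^ Suc (Suc m) - (1/2 + (-1) * (1/6)) ^ Suc (Suc m)) / ((-1) * real (Suc (Suc m))))"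
    using q M by (intro nn_integral_power_linear) auto
  also have "real (Suc (Suc m)) = M + 1" unfolding M_def by simp
  also have "1 + (-4) * (1/6) = (1/3::real)" by simp
  also have "1/2 + (-1) * (1/6) = (1/3::real)" by simp
  also have "(1/3::real) ^ Suc (Suc m) = q / 3" unfolding q_def by simp
  also have "q * 3 / (4 * M) * ((0 + 1 * (1/6)) ^ Suc 0 - (0 + 1 * 0) ^ Suc 0) / (1 * real (Suc 0)) = q * 3 / (4 * M) / 6"
    by simp
  also have "1 / (4 * M) * (q / 3 - (1 + (-4) * 0) ^ Suc (Suc m)) / ((-4) * (M + 1)) = (1 - q / 3) / (16 * M * (M + 1))"
  proof -
    have "1 / (4 * M) * (q / 3 - 1) / ((-4) * (M + 1)) = (1 - q / 3) / (16 * M * (M + 1))"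
      using M by (simp add: divide_simps) (simp add: algebra_simps)
    then show ?thesis by simp
  qed
  also have "1 / M * ((1/2 + (-1) * (1/2)) ^ Suc (Suc m) - q / 3) / ((-1) * (M + 1)) = q / 3 / (M * (M + 1))"
  proof -
    have "1 / M * (0 - q / 3) / ((-1) * (M + 1)) = q / 3 / (M * (M + 1))"
      using M by (simp add: divide_simps) (simp add: algebra_simps)?
    then show ?thesis by simp
  qed
  also have "ennreal (q * 3 / (4 * M) / 6) + ennreal ((1 - q / 3) / (16 * M * (M + 1))) + ennreal (q / 3 / (M * (M + 1)))
     = ennreal (q * 3 / (4 * M) / 6 + (1 - q / 3) / (16 * M * (M + 1)) + q / 3 / (M * (M + 1)))"
    using q M by (simp flip: ennreal_plus)
  also have "q * 3 / (4 * M) / 6 + (1 - q / 3) / (16 * M * (M + 1)) + q / 3 / (M * (M + 1))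
      = (1 + (1/3) ^ m * (2 * real m + 9) / 3) / (16 * (real m + 1) * (real m + 2))"
  proof -
    have m: "real m = M - 1" unfolding M_def by simp
    show ?thesis unfolding m q(3) using M by (simp add: divide_simps) (simp add: algebra_simps)
  qed
  finally show ?thesis .
qed

lemma nn_integral_sectors_eq:
  fixes G :: "real \<Rightarrow> real \<Rightarrow> ennreal"
  assumes "(\<lambda>(x, y). G x y) \<in> borel_measurable (borel \<Otimes>\<^sub>M borel)" "\<And>x y. G (- x) (- y) = G x y"
    and "(\<integral>\<^sup>+ y. \<integral>\<^sup>+ x. (if x < 0 \<and> 0 < y then G x y else 0) \<partial>lborel \<partial>lborel) = ennreal a"
    and "(\<integral>\<^sup>+ y. \<integral>\<^sup>+ x. (if 0 < x \<and> x < y then G x y else 0) \<partial>lborel \<partial>lborel) = ennreal b"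
    and "(\<integral>\<^sup>+ y. \<integral>\<^sup>+ x. (if 0 < y \<and> y < x then G x y else 0) \<partial>lborel \<partial>lborel) = ennreal c"
    and "0 \<le> a" "0 \<le> b" "0 \<le> c" "d = 2 * (a + b + c)"
  shows "(\<integral>\<^sup>+ y. \<integral>\<^sup>+ x. G x y \<partial>lborel \<partial>lborel) = ennreal d"
proof -
  have "ennreal (2 * (a + b + c)) = ennreal 2 * ennreal (a + b + c)"
    by (rule ennreal_mult') simp
  also have "ennreal (a + b + c) = ennreal a + ennreal b + ennreal c"
    by (simp only: ennreal_plus assms(6-8) add_nonneg_nonneg)
  also have "ennreal 2 = 2" by simp
  finally show ?thesis unfolding nn_integral_sectors[OF assms(1,2)] assms(3-5) assms(9) ..
qed

text \<open>For \<open>m = n - 2\<close> the value is \<open>1 / (n * (n - 1))\<close>, as it must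
  be: the cells of the ordered pairs cover the circle up to a null set and have equal expected
  lengths.\<close>

lemma double_integral_0:
  "(\<integral>\<^sup>+ y. \<integral>\<^sup>+ x. (if \<bar>x\<bar> + \<bar>y\<bar> < 1/2 then ennreal ((2 * (1/2 - \<bar>x\<bar> - \<bar>y\<bar>)) ^ m) else 0) \<partial>lborel \<partial>lborel)
    = ennreal (1 / ((real m + 1) * (real m + 2)))"
proof -
  let ?G = "\<lambda>x y :: real. if \<bar>x\<bar> + \<bar>y\<bar> < 1/2 then ennreal ((2 * (1/2 - \<bar>x\<bar> - \<bar>y\<bar>)) ^ m) else 0"
  have meas: "(\<lambda>(x, y). ?G x y) \<in> borel_measurable (borel \<Otimes>\<^sub>M borel)" by measurable
  have T1: "(\<integral>\<^sup>+ y. \<integral>\<^sup>+ x. (if x < 0 \<and> 0 < y then ?G x y else 0) \<partial>lborel \<partial>lborel)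
      = ennreal (1 / (4 * (real m + 1) * (real m + 2)))"
    unfolding sector_0_left[symmetric]
    by (intro nn_integral_cong if_cong refl arg_cong[where f = "\<lambda>t. ennreal (t ^ m)"]) auto
  have T3: "(\<integral>\<^sup>+ y. \<integral>\<^sup>+ x. (if 0 < y \<and> y < x then ?G x y else 0) \<partial>lborel \<partial>lborel)
      = ennreal (1 / (8 * (real m + 1) * (real m + 2)))"
    unfolding sector_A_middle[symmetric]
    by (intro nn_integral_cong if_cong refl arg_cong[where f = "\<lambda>t. ennreal (t ^ m)"]) auto
  have T2: "(\<integral>\<^sup>+ y. \<integral>\<^sup>+ x. (if 0 < x \<and> x < y then ?G x y else 0) \<partial>lborel \<partial>lborel)
      = ennreal (1 / (8 * (real m + 1) * (real m + 2)))"
    unfolding T3[symmetric] nn_integral_swap_sector[OF meas]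
    by (auto intro!: nn_integral_cong simp: algebra_simps)
  have eq: "1 / K = 2 * (1 / (4 * K) + 1 / (8 * K) + 1 / (8 * K))" if "K \<noteq> 0" for K q r :: real
    using that by (simp add: divide_simps) (simp add: algebra_simps)?
  have sym: "?G (- x) (- y) = ?G x y" for x y
  proof -
    have "\<bar>- x - - y\<bar> = \<bar>x - y\<bar>" by simp
    then show ?thesis by (simp only: abs_minus_cancel)
  qed
  show ?thesis
    by (rule nn_integral_sectors_eq[OF meas sym T1 T2 T3])
      (simp_all only: mult.assoc, rule_tac [4] eq, simp_all)
qed

text \<open>A condition on \<open>p\<close> alone is not symmetric in \<open>x\<close> and
  \<open>y\<close>, so the three sectors have three different integrands.\<close>

lemma double_integral_A:
  "(\<integral>\<^sup>+ y. \<integral>\<^sup>+ x. (if \<bar>x\<bar> + \<bar>y\<bar> < 1/2 then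
      ennreal ((1/2 - \<bar>x\<bar> - \<bar>y\<bar> + max 0 (1/2 - 2 * \<bar>x\<bar> - \<bar>x - y\<bar>)) ^ m) else 0) \<partial>lborel \<partial>lborel)
    = ennreal ((5 + 3 * (1/3) ^ m) / (8 * (real m + 1) * (real m + 2)))"
proof -
  let ?G = "\<lambda>x y :: real. if \<bar>x\<bar> + \<bar>y\<bar> < 1/2 then
    ennreal ((1/2 - \<bar>x\<bar> - \<bar>y\<bar> + max 0 (1/2 - 2 * \<bar>x\<bar> - \<bar>x - y\<bar>)) ^ m) else 0"
  have meas: "(\<lambda>(x, y). ?G x y) \<in> borel_measurable (borel \<Otimes>\<^sub>M borel)" by measurable
  have T1: "(\<integral>\<^sup>+ y. \<integral>\<^sup>+ x. (if x < 0 \<and> 0 < y then ?G x y else 0) \<partial>lborel \<partial>lborel)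
      = ennreal ((1 + (1/3) ^ m) / (8 * (real m + 1) * (real m + 2)))"
    unfolding sector_A_left[symmetric]
    by (intro nn_integral_cong if_cong refl arg_cong[where f = "\<lambda>t. ennreal (t ^ m)"]) (auto simp: max_def)
  have T3: "(\<integral>\<^sup>+ y. \<integral>\<^sup>+ x. (if 0 < y \<and> y < x then ?G x y else 0) \<partial>lborel \<partial>lborel)
      = ennreal ((1 + (1/3) ^ m) / (16 * (real m + 1) * (real m + 2)))"
    unfolding sector_AB_right[symmetric]
    by (intro nn_integral_cong if_cong refl arg_cong[where f = "\<lambda>t. ennreal (t ^ m)"]) (auto simp: max_def)
  have T2: "(\<integral>\<^sup>+ y. \<integral>\<^sup>+ x. (if 0 < x \<and> x < y then ?G x y else 0) \<partial>lborel \<partial>lborel)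
      = ennreal (1 / (8 * (real m + 1) * (real m + 2)))"
    unfolding sector_A_middle[symmetric] nn_integral_swap_sector[OF meas]
    by (intro nn_integral_cong if_cong refl arg_cong[where f = "\<lambda>t. ennreal (t ^ m)"]) (auto simp: max_def)
  have eq: "(5 + 3 * q) / (8 * K) = 2 * ((1 + q) / (8 * K) + 1 / (8 * K) + (1 + q) / (16 * K))" if "K \<noteq> 0" for K q r :: real
    using that by (simp add: divide_simps) (simp add: algebra_simps)?
  have sym: "?G (- x) (- y) = ?G x y" for x y
  proof -
    have "\<bar>- x - - y\<bar> = \<bar>x - y\<bar>" by simp
    then show ?thesis by (simp only: abs_minus_cancel)
  qed
  show ?thesis
    by (rule nn_integral_sectors_eq[OF meas sym T1 T2 T3])
      (simp_all only: mult.assoc, rule_tac [4] eq, simp_all)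
qed

text \<open>With both conditions the integrand is symmetric in \<open>x\<close> and
  \<open>y\<close>, so the two sectors beside the diagonal agree.\<close>

lemma double_integral_B:
  "(\<integral>\<^sup>+ y. \<integral>\<^sup>+ x. (if \<bar>x\<bar> + \<bar>y\<bar> < 1/2 then
      ennreal ((1/2 - \<bar>x\<bar> - \<bar>y\<bar> + max 0 (1/2 - \<bar>x\<bar> - \<bar>y\<bar> - 2 * \<bar>x - y\<bar>)) ^ m) else 0) \<partial>lborel \<partial>lborel)
    = ennreal ((3 + (1/3) ^ m * (2 * real m + 15) / 3) / (8 * (real m + 1) * (real m + 2)))"
proof -
  let ?G = "\<lambda>x y :: real. if \<bar>x\<bar> + \<bar>y\<bar> < 1/2 then
    ennreal ((1/2 - \<bar>x\<bar> - \<bar>y\<bar> + max 0 (1/2 - \<bar>x\<bar> - \<bar>y\<bar> - 2 * \<bar>x - y\<bar>)) ^ m) else 0"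
  have meas: "(\<lambda>(x, y). ?G x y) \<in> borel_measurable (borel \<Otimes>\<^sub>M borel)" by measurable
  have T1: "(\<integral>\<^sup>+ y. \<integral>\<^sup>+ x. (if x < 0 \<and> 0 < y then ?G x y else 0) \<partial>lborel \<partial>lborel)
      = ennreal ((1 + (1/3) ^ m * (2 * real m + 9) / 3) / (16 * (real m + 1) * (real m + 2)))"
    unfolding sector_B_left[symmetric]
    by (intro nn_integral_cong if_cong refl arg_cong[where f = "\<lambda>t. ennreal (t ^ m)"]) (auto simp: max_def)
  have T3: "(\<integral>\<^sup>+ y. \<integral>\<^sup>+ x. (if 0 < y \<and> y < x then ?G x y else 0) \<partial>lborel \<partial>lborel)
      = ennreal ((1 + (1/3) ^ m) / (16 * (real m + 1) * (real m + 2)))"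
    unfolding sector_AB_right[symmetric]
    by (intro nn_integral_cong if_cong refl arg_cong[where f = "\<lambda>t. ennreal (t ^ m)"]) (auto simp: max_def)
  have T2: "(\<integral>\<^sup>+ y. \<integral>\<^sup>+ x. (if 0 < x \<and> x < y then ?G x y else 0) \<partial>lborel \<partial>lborel)
      = ennreal ((1 + (1/3) ^ m) / (16 * (real m + 1) * (real m + 2)))"
    unfolding sector_AB_right[symmetric] nn_integral_swap_sector[OF meas]
    by (intro nn_integral_cong if_cong refl arg_cong[where f = "\<lambda>t. ennreal (t ^ m)"]) (auto simp: max_def)
  have eq: "(3 + q * (2 * r + 15) / 3) / (8 * K) = 2 * ((1 + q * (2 * r + 9) / 3) / (16 * K) + (1 + q) / (16 * K) + (1 + q) / (16 * K))" if "K \<noteq> 0" for K q r :: real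
    using that by (simp add: divide_simps) (simp add: algebra_simps)?
  have sym: "?G (- x) (- y) = ?G x y" for x y
  proof -
    have "\<bar>- x - - y\<bar> = \<bar>x - y\<bar>" by simp
    then show ?thesis by (simp only: abs_minus_cancel)
  qed
  show ?thesis
    by (rule nn_integral_sectors_eq[OF meas sym T1 T2 T3])
      (simp_all only: mult.assoc, rule_tac [4] eq, simp_all)
qed

section \<open>Admissible arcs\<close>

lemma cos_2pi_less_iff:
  assumes "0 \<le> a" "a \<le> 1/2" "0 \<le> b" "b \<le> 1/2"
  shows "cos (2 * pi * a) < cos (2 * pi * b) \<longleftrightarrow> b < a"
  using assms by (subst cos_mono_less_eq) auto

lemma cos_2pi_abs: "cos (2 * pi * \<bar>d\<bar>) = cos (2 * pi * d)"
  by (cases "d \<ge> 0") auto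

text \<open>For parameters differing by at most 1 the minimum is their circle distance, which lies
  in the range where the cosine is monotone.\<close>

lemma cos_2pi_circle_dist:
  "cos (2 * pi * min \<bar>d\<bar> (1 - \<bar>d\<bar>)) = cos (2 * pi * d)"
proof -
  have "cos (2 * pi * (1 - \<bar>d\<bar>)) = cos (2 * pi * d)"
    by (simp add: right_diff_distrib cos_diff cos_2pi_abs)
  then show ?thesis by (simp add: min_def cos_2pi_abs)
qed

lemma cos_2pi_half: "cos (2 * pi * (1/2 - d)) = - cos (2 * pi * d)"
  by (simp add: right_diff_distrib cos_diff)

lemma cis_inner: "cis a \<bullet> cis b = cos (a - b)"
  by (simp add: inner_complex_def cos_diff)

text \<open>\<open>w\<close> can be added to the configuration \<open>p\<close>, \<open>q\<close> without destroying that \<open>p\<close> is nearest and \<open>q\<close>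
  farthest from \<open>z\<close>, that \<open>q\<close> is farthest from \<open>p\<close> (if \<open>\<alpha>\<close>), and that \<open>p\<close> is farthest from \<open>q\<close>
  (if \<open>\<beta>\<close>).\<close>

definition compatible :: "bool \<Rightarrow> bool \<Rightarrow> complex \<Rightarrow> complex \<Rightarrow> complex \<Rightarrow> complex \<Rightarrow> bool" where
  "compatible \<alpha> \<beta> z p q w \<longleftrightarrow> z \<bullet> w < z \<bullet> p \<and> z \<bullet> q < z \<bullet> w \<and> (\<alpha> \<longrightarrow> p \<bullet> q < p \<bullet> w) \<and> (\<beta> \<longrightarrow> q \<bullet> p < q \<bullet> w)"

text \<open>With \<open>y\<close> the parameter of the antipode of \<open>q\<close>, the circle
  distance from 1 to \<open>q\<close> is \<open>1/2 - \<bar>y\<bar>\<close>. This is what makes the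
  domain of integration a square centered at the origin.\<close>

lemma inner_1_order_iff:
  assumes "\<bar>x\<bar> \<le> 1/2" "\<bar>y\<bar> \<le> 1/2"
  shows "1 \<bullet> (- cis (2 * pi * y)) < 1 \<bullet> cis (2 * pi * x) \<longleftrightarrow> \<bar>x\<bar> + \<bar>y\<bar> < 1/2"
proof -
  have "1 \<bullet> (- cis (2 * pi * y)) = cos (2 * pi * (1/2 - \<bar>y\<bar>))"
    by (simp add: cos_2pi_half cos_2pi_abs inner_complex_def)
  moreover have "1 \<bullet> cis (2 * pi * x) = cos (2 * pi * \<bar>x\<bar>)"
    by (simp add: cos_2pi_abs inner_complex_def)
  ultimately show ?thesis using assms by (simp only:) (subst cos_2pi_less_iff, auto)
qed

text \<open>Each comparison of inner products becomes one of circle distances. Under \<alpha> the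
  distance from \<open>p\<close> to \<open>w\<close> is below that from \<open>p\<close> to
  \<open>q\<close>, which is \<open>1/2 - \<bar>x - y\<bar>\<close>; under \<beta> distances are
  taken to the antipode of \<open>q\<close>, which reverses the inequality.\<close>

lemma compatible_iff:
  assumes xy: "\<bar>x\<bar> + \<bar>y\<bar> < 1/2" and s: "\<bar>s\<bar> \<le> 1/2"
  shows "compatible \<alpha> \<beta> 1 (cis (2 * pi * x)) (- cis (2 * pi * y)) (cis (2 * pi * s)) \<longleftrightarrow>
    \<bar>x\<bar> < \<bar>s\<bar> \<and> \<bar>s\<bar> < 1/2 - \<bar>y\<bar> \<and> (\<alpha> \<longrightarrow> min \<bar>s - x\<bar> (1 - \<bar>s - x\<bar>) < 1/2 - \<bar>x - y\<bar>)
    \<and> (\<beta> \<longrightarrow> \<bar>x - y\<bar> < min \<bar>s - y\<bar> (1 - \<bar>s - y\<bar>))"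
proof -
  let ?C = "\<lambda>t. cos (2 * pi * t)"
  have b: "\<bar>s - x\<bar> < 1" "\<bar>s - y\<bar> < 1" "\<bar>x - y\<bar> < 1/2" "\<bar>x\<bar> < 1/2" "\<bar>y\<bar> < 1/2"
    using xy s by linarith+
  have one: "1 \<bullet> cis (2 * pi * t) = ?C \<bar>t\<bar>" for t
    by (simp add: cos_2pi_abs inner_complex_def)
  have q: "1 \<bullet> (- cis (2 * pi * y)) = ?C (1/2 - \<bar>y\<bar>)"
    by (simp add: cos_2pi_half cos_2pi_abs inner_complex_def)
  have pq: "cis (2 * pi * x) \<bullet> (- cis (2 * pi * y)) = ?C (1/2 - \<bar>x - y\<bar>)"
    by (simp add: cis_inner cos_2pi_half cos_2pi_abs flip: right_diff_distrib)
  have qp: "(- cis (2 * pi * y)) \<bullet> cis (2 * pi * x) = - ?C \<bar>x - y\<bar>"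
    by (subst inner_commute) (simp add: cis_inner cos_2pi_abs flip: right_diff_distrib)
  have ps: "cis (2 * pi * x) \<bullet> cis (2 * pi * s) = ?C (min \<bar>s - x\<bar> (1 - \<bar>s - x\<bar>))"
    unfolding cos_2pi_circle_dist by (subst inner_commute) (simp add: cis_inner flip: right_diff_distrib)
  have qs: "(- cis (2 * pi * y)) \<bullet> cis (2 * pi * s) = - ?C (min \<bar>s - y\<bar> (1 - \<bar>s - y\<bar>))"
    unfolding cos_2pi_circle_dist by (subst inner_commute) (simp add: cis_inner flip: right_diff_distrib)
  have "?C \<bar>s\<bar> < ?C \<bar>x\<bar> \<longleftrightarrow> \<bar>x\<bar> < \<bar>s\<bar>"
    using b s by (intro cos_2pi_less_iff) auto
  moreover have "?C (1/2 - \<bar>y\<bar>) < ?C \<bar>s\<bar> \<longleftrightarrow> \<bar>s\<bar> < 1/2 - \<bar>y\<bar>"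
    using b s by (intro cos_2pi_less_iff) auto
  moreover have "?C (1/2 - \<bar>x - y\<bar>) < ?C (min \<bar>s - x\<bar> (1 - \<bar>s - x\<bar>)) \<longleftrightarrow>
      min \<bar>s - x\<bar> (1 - \<bar>s - x\<bar>) < 1/2 - \<bar>x - y\<bar>"
    using b by (intro cos_2pi_less_iff) (auto simp: min_def)
  moreover have "?C (min \<bar>s - y\<bar> (1 - \<bar>s - y\<bar>)) < ?C \<bar>x - y\<bar> \<longleftrightarrow>
      \<bar>x - y\<bar> < min \<bar>s - y\<bar> (1 - \<bar>s - y\<bar>)"
    using b by (intro cos_2pi_less_iff) (auto simp: min_def)
  ultimately show ?thesis
    unfolding compatible_def one q pq qp ps qs neg_less_iff_less by blast
qed

lemma emeasure_lborel_two_intervals: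
  fixes a b c d :: real
  assumes "A = {a<..<b} \<union> {c<..<d}" "b \<le> c \<or> b \<le> a \<or> d \<le> c" "v = max 0 (b - a) + max 0 (d - c)"
  shows "emeasure lborel A = ennreal v"
proof -
  have Ioo: "emeasure lborel {a<..<b} = ennreal (max 0 (b - a))" for a b :: real
    by (cases "a \<le> b") auto
  have "{a<..<b} \<inter> {c<..<d} = {}" using assms by auto
  then have "emeasure lborel ({a<..<b} \<union> {c<..<d}) = emeasure lborel {a<..<b} + emeasure lborel {c<..<d}"
    by (intro plus_emeasure[symmetric]) auto
  then show ?thesis unfolding Ioo assms by simp
qed

lemma emeasure_arcs_0:
  fixes x y :: real
  assumes "\<bar>x\<bar> + \<bar>y\<bar> < 1/2"
  shows "emeasure lborel {s. \<bar>x\<bar> < \<bar>s\<bar> \<and> \<bar>s\<bar> < 1/2 - \<bar>y\<bar>} = ennreal (2 * (1/2 - \<bar>x\<bar> - \<bar>y\<bar>))"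
proof -
  have "{s. \<bar>x\<bar> < \<bar>s\<bar> \<and> \<bar>s\<bar> < 1/2 - \<bar>y\<bar>} = {- (1/2 - \<bar>y\<bar>)<..<- \<bar>x\<bar>} \<union> {\<bar>x\<bar><..<1/2 - \<bar>y\<bar>}"
    by auto
  then show ?thesis by (rule emeasure_lborel_two_intervals) (use assms in auto)
qed

text \<open>The arc on the side of \<open>p\<close> survives whole by the triangle inequality. The
  other one is cut at the circle distance from \<open>p\<close> to \<open>q\<close>, and disappears
  once the cut passes its near end.\<close>

lemma emeasure_arcs_A:
  fixes x y :: real
  assumes xy: "\<bar>x\<bar> + \<bar>y\<bar> < 1/2"
  shows "emeasure lborel {s. \<bar>x\<bar> < \<bar>s\<bar> \<and> \<bar>s\<bar> < 1/2 - \<bar>y\<bar> \<and> min \<bar>s - x\<bar> (1 - \<bar>s - x\<bar>) < 1/2 - \<bar>x - y\<bar>}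
    = ennreal (1/2 - \<bar>x\<bar> - \<bar>y\<bar> + max 0 (1/2 - 2 * \<bar>x\<bar> - \<bar>x - y\<bar>))" (is "emeasure _ ?T = _")
proof (cases "x \<ge> 0")
  case True
  have "?T = {- (1/2 - x - \<bar>x - y\<bar>)<..<- x} \<union> {x<..<1/2 - \<bar>y\<bar>}"
    using True xy by (auto simp: min_def abs_if split: if_splits)
  then show ?thesis
      by (rule emeasure_lborel_two_intervals) (use True xy in \<open>auto simp: max_def abs_if\<close>)
next
  case False
  have "?T = {- (1/2 - \<bar>y\<bar>)<..<x} \<union> {- x<..<1/2 + x - \<bar>x - y\<bar>}"
    using False xy by (auto simp: min_def abs_if split: if_splits)
  then show ?thesis
      by (rule emeasure_lborel_two_intervals) (use False xy in \<open>auto simp: max_def abs_if\<close>)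
qed

text \<open>The new interval ends are reflections: \<open>2 * y - x\<close> is \<open>p\<close>
  reflected in the axis through \<open>q\<close>, and \<open>2 * x - y\<close> shifted by 1/2 is
  \<open>q\<close> reflected in the axis through \<open>p\<close>. Which arc is cut, and at which
  end, depends on the order of \<open>x\<close>, \<open>y\<close> and 0; in every case one arc is
  intact and the other loses \<open>2 * \<bar>x - y\<bar>\<close>.\<close>

lemma emeasure_arcs_B:
  fixes x y :: real
  assumes xy: "\<bar>x\<bar> + \<bar>y\<bar> < 1/2"
  shows "emeasure lborel {s. \<bar>x\<bar> < \<bar>s\<bar> \<and> \<bar>s\<bar> < 1/2 - \<bar>y\<bar> \<and> min \<bar>s - x\<bar> (1 - \<bar>s - x\<bar>) < 1/2 - \<bar>x - y\<bar>
      \<and> \<bar>x - y\<bar> < min \<bar>s - y\<bar> (1 - \<bar>s - y\<bar>)}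
    = ennreal (1/2 - \<bar>x\<bar> - \<bar>y\<bar> + max 0 (1/2 - \<bar>x\<bar> - \<bar>y\<bar> - 2 * \<bar>x - y\<bar>))" (is "emeasure _ ?T = _")
proof -
  consider "x \<ge> 0" "y < 0" | "0 \<le> y" "y \<le> x" | "0 \<le> x" "x < y"
    | "x < 0" "0 \<le> y" | "x < 0" "y < 0" "x \<le> y" | "x < 0" "y < 0" "y < x" by linarith
  then show ?thesis
  proof cases
    case 1
    have "?T = {- (1/2 - 2 * x + y)<..<- (x - 2 * y)} \<union> {x<..<1/2 + y}"
      using 1 xy by (auto simp: min_def abs_if split: if_splits)
    then show ?thesis
      by (rule emeasure_lborel_two_intervals) (use 1 xy in \<open>auto simp: max_def abs_if\<close>)
  next
    case 2
    have "?T = {- (1/2 - 2 * x + y)<..<- x} \<union> {x<..<1/2 - y}"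
      using 2 xy by (auto simp: min_def abs_if split: if_splits)
    then show ?thesis
      by (rule emeasure_lborel_two_intervals) (use 2 xy in \<open>auto simp: max_def abs_if\<close>)
  next
    case 3
    have "?T = {- (1/2 - y)<..<- x} \<union> {2 * y - x<..<1/2 - y}"
      using 3 xy by (auto simp: min_def abs_if split: if_splits)
    then show ?thesis
      by (rule emeasure_lborel_two_intervals) (use 3 xy in \<open>auto simp: max_def abs_if\<close>)
  next
    case 4
    have "?T = {- (1/2 - y)<..<x} \<union> {2 * y - x<..<1/2 + 2 * x - y}"
      using 4 xy by (auto simp: min_def abs_if split: if_splits)
    then show ?thesis
      by (rule emeasure_lborel_two_intervals) (use 4 xy in \<open>auto simp: max_def abs_if\<close>)
  next
    case 5
    have "?T = {- (1/2 + y)<..<x} \<union> {- x<..<1/2 + 2 * x - y}"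
      using 5 xy by (auto simp: min_def abs_if split: if_splits)
    then show ?thesis
      by (rule emeasure_lborel_two_intervals) (use 5 xy in \<open>auto simp: max_def abs_if\<close>)
  next
    case 6
    have "?T = {- (1/2 + y)<..<2 * y - x} \<union> {- x<..<1/2 + y}"
      using 6 xy by (auto simp: min_def abs_if split: if_splits)
    then show ?thesis
      by (rule emeasure_lborel_two_intervals) (use 6 xy in \<open>auto simp: max_def abs_if\<close>)
  qed
qed

section \<open>Expected lengths\<close>

interpretation unif: prob_space uniform_circle by (rule prob_space_uniform_circle)

interpretation unifs: product_sigma_finite "\<lambda>_ :: nat. uniform_circle" ..

text \<open>Given the coordinates \<open>i\<close> and \<open>j\<close>, the event is a product box
  in the other \<open>n - 2\<close> independent coordinates, hence the power. The coordinate
  \<open>j\<close> is split off first, so \<open>q\<close> is the outer variable.\<close>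

lemma emeasure_PiM_two_special:
  fixes n :: nat and R :: "complex \<Rightarrow> complex \<Rightarrow> bool" and P :: "complex \<Rightarrow> complex \<Rightarrow> complex \<Rightarrow> bool"
  assumes ij: "i < n" "j < n" "i \<noteq> j"
    and R [measurable]: "Measurable.pred (uniform_circle \<Otimes>\<^sub>M uniform_circle) (\<lambda>(p, q). R p q)"
    and P [measurable]: "Measurable.pred (uniform_circle \<Otimes>\<^sub>M uniform_circle \<Otimes>\<^sub>M uniform_circle) (\<lambda>(p, q, w). P p q w)"
  shows "emeasure (Pi\<^sub>M {..<n} (\<lambda>_. uniform_circle))
      {x \<in> space (Pi\<^sub>M {..<n} (\<lambda>_. uniform_circle)). R (x i) (x j) \<and> (\<forall>k\<in>{..<n} - {i, j}. P (x i) (x j) (x k))}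
    = (\<integral>\<^sup>+ q. \<integral>\<^sup>+ p. (if R p q then emeasure uniform_circle {w \<in> sphere 0 1. P p q w} ^ (n - 2) else 0)
        \<partial>uniform_circle \<partial>uniform_circle)"
proof -
  let ?U = uniform_circle
  define I where "I = {..<n} - {i, j}"
  have I: "finite I" "i \<notin> I" "j \<notin> insert i I" "{..<n} = insert j (insert i I)" "card I = n - 2"
    using ij unfolding I_def by auto
  let ?N = "Pi\<^sub>M (insert j (insert i I)) (\<lambda>_. ?U)"
  let ?S = "{x \<in> space ?N. R (x i) (x j) \<and> (\<forall>k\<in>I. P (x i) (x j) (x k))}"
  have RR [measurable (raw)]: "Measurable.pred M (\<lambda>x. R (f x) (g x))"
    if "f \<in> M \<rightarrow>\<^sub>M ?U" "g \<in> M \<rightarrow>\<^sub>M ?U" for M :: "'b measure" and f g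
    using measurable_compose[OF measurable_Pair[OF that] R] by simp
  have PP [measurable (raw)]: "Measurable.pred M (\<lambda>x. P (f x) (g x) (h x))"
    if "f \<in> M \<rightarrow>\<^sub>M ?U" "g \<in> M \<rightarrow>\<^sub>M ?U" "h \<in> M \<rightarrow>\<^sub>M ?U" for M :: "'b measure" and f g h
    using measurable_compose[OF measurable_Pair[OF that(1) measurable_Pair[OF that(2,3)]] P] by simp
  have S [measurable]: "?S \<in> sets ?N"
  proof -
    have "Measurable.pred ?N (\<lambda>x. P (x i) (x j) (x k))" if "k \<in> I" for k
      using that by (intro PP measurable_component_singleton) auto
    moreover have "Measurable.pred ?N (\<lambda>x. R (x i) (x j))"
      by (intro RR measurable_component_singleton) auto
    ultimately have "Measurable.pred ?N (\<lambda>x. R (x i) (x j) \<and> (\<forall>k\<in>I. P (x i) (x j) (x k)))"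
      using I(1) by (intro pred_intros_logic pred_intros_finite) auto
    then show ?thesis by (simp add: pred_def)
  qed
  have "emeasure ?N ?S = (\<integral>\<^sup>+ x. indicator ?S x \<partial>?N)" using S by simp
  also have "\<dots> = (\<integral>\<^sup>+ q. \<integral>\<^sup>+ x. indicator ?S (x(j := q)) \<partial>Pi\<^sub>M (insert i I) (\<lambda>_. ?U) \<partial>?U)"
    using I by (intro unifs.product_nn_integral_insert_rev) auto
  also have "\<dots> = (\<integral>\<^sup>+ q. \<integral>\<^sup>+ p. (if R p q then emeasure ?U {w \<in> sphere 0 1. P p q w} ^ (n - 2) else 0) \<partial>?U \<partial>?U)"
  proof (rule nn_integral_cong)
    fix q assume q: "q \<in> space ?U"
    have "(\<lambda>x. indicator ?S (x(j := q)) :: ennreal) \<in> borel_measurable (Pi\<^sub>M (insert i I) (\<lambda>_. ?U))"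
    proof -
      have "(\<lambda>x. x(j := q)) \<in> Pi\<^sub>M (insert i I) (\<lambda>_. ?U) \<rightarrow>\<^sub>M ?N"
        using q by (intro measurable_fun_upd[where J = "insert i I"]) auto
      then show ?thesis by measurable
    qed
    then have "(\<integral>\<^sup>+ x. indicator ?S (x(j := q)) \<partial>Pi\<^sub>M (insert i I) (\<lambda>_. ?U))
      = (\<integral>\<^sup>+ p. \<integral>\<^sup>+ x. indicator ?S ((x(i := p))(j := q)) \<partial>Pi\<^sub>M I (\<lambda>_. ?U) \<partial>?U)"
      using I by (intro unifs.product_nn_integral_insert_rev) auto
    also have "\<dots> = (\<integral>\<^sup>+ p. (if R p q then emeasure ?U {w \<in> sphere 0 1. P p q w} ^ (n - 2) else 0) \<partial>?U)"
    proof (rule nn_integral_cong)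
      fix p assume p: "p \<in> space ?U"
      let ?W = "{w \<in> sphere 0 1. P p q w}"
      have W: "?W \<in> sets ?U"
      proof -
        have "Measurable.pred ?U (\<lambda>w. P p q w)" using p q by (intro PP) auto
        then show ?thesis by (simp add: pred_def)
      qed
      have "(\<integral>\<^sup>+ x. indicator ?S ((x(i := p))(j := q)) \<partial>Pi\<^sub>M I (\<lambda>_. ?U))
        = (\<integral>\<^sup>+ x. (if R p q then 1 else 0) * indicator (Pi\<^sub>E I (\<lambda>_. ?W)) x \<partial>Pi\<^sub>M I (\<lambda>_. ?U))"
      proof (rule nn_integral_cong)
        fix x assume x: "x \<in> space (Pi\<^sub>M I (\<lambda>_. ?U))"
        let ?x = "(x(i := p))(j := q)"
        have "?x \<in> space ?N" using x p q by (auto simp: space_PiM PiE_def extensional_def)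
        moreover have "?x i = p" "?x j = q" "\<And>k. k \<in> I \<Longrightarrow> ?x k = x k" using ij I by auto
        ultimately have "?x \<in> ?S \<longleftrightarrow> R p q \<and> (\<forall>k\<in>I. P p q (x k))" by auto
        moreover have "x \<in> Pi\<^sub>E I (\<lambda>_. ?W) \<longleftrightarrow> (\<forall>k\<in>I. P p q (x k))"
          using x by (auto simp: space_PiM PiE_def Pi_def)
        ultimately show "indicator ?S ?x = (if R p q then 1 else 0) * (indicator (Pi\<^sub>E I (\<lambda>_. ?W)) x :: ennreal)"
          by (auto simp: indicator_def)
      qed
      also have "\<dots> = (if R p q then 1 else 0) * emeasure (Pi\<^sub>M I (\<lambda>_. ?U)) (Pi\<^sub>E I (\<lambda>_. ?W))"
        using W I by (subst nn_integral_cmult_indicator) (auto intro!: sets_PiM_I_finite)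
      also have "emeasure (Pi\<^sub>M I (\<lambda>_. ?U)) (Pi\<^sub>E I (\<lambda>_. ?W)) = emeasure ?U ?W ^ (n - 2)"
        using W I by (subst unifs.emeasure_PiM) auto
      also have "(if R p q then 1 else 0) * emeasure ?U ?W ^ (n - 2)
          = (if R p q then emeasure ?U ?W ^ (n - 2) else 0)" by simp
      finally show "(\<integral>\<^sup>+ x. indicator ?S ((x(i := p))(j := q)) \<partial>Pi\<^sub>M I (\<lambda>_. ?U))
          = (if R p q then emeasure ?U ?W ^ (n - 2) else 0)" .
    qed
    finally show "(\<integral>\<^sup>+ x. indicator ?S (x(j := q)) \<partial>Pi\<^sub>M (insert i I) (\<lambda>_. ?U))
      = (\<integral>\<^sup>+ p. (if R p q then emeasure ?U {w \<in> sphere 0 1. P p q w} ^ (n - 2) else 0) \<partial>?U)" .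
  qed
  finally show ?thesis unfolding I(4)[symmetric] unfolding I_def .
qed

lemma emeasure_uniform_circle_singleton: "emeasure uniform_circle {q} = 0"
proof (cases "q \<in> sphere 0 1")
  case True
  have [measurable]: "{q} \<in> sets circle_borel"
    using True unfolding circle_borel_def by (auto simp: sets_restrict_space image_iff intro!: bexI[of _ "{q}"])
  have "emeasure uniform_circle {q} = (\<integral>\<^sup>+ w. indicator {q} w \<partial>uniform_circle)" by simp
  also have "\<dots> = (\<integral>\<^sup>+ t. indicator {q} (cis (2 * pi * t)) * indicator {0..<1} t \<partial>lborel)"
    by (rule nn_integral_uniform_circle) simp
  also have "\<dots> \<le> (\<integral>\<^sup>+ t. indicator {Arg2pi q / (2 * pi)} t \<partial>lborel)"
  proof (intro nn_integral_mono)
    fix t :: real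
    have "t = Arg2pi q / (2 * pi)" if "cis (2 * pi * t) = q" "0 \<le> t" "t < 1"
      using Arg2pi_unique[of 1 "2 * pi * t" q] that by (simp add: cis_conv_exp)
    then show "indicator {q} (cis (2 * pi * t)) * indicator {0..<1} t
        \<le> (indicator {Arg2pi q / (2 * pi)} t :: ennreal)"
      by (auto simp: indicator_def)
  qed
  finally show ?thesis by simp
next
  case False
  then have "{q} \<notin> sets uniform_circle" using sets.sets_into_space[of "{q}" uniform_circle] by auto
  then show ?thesis by (rule emeasure_notin_sets)
qed

lemma AE_PiM_inj_on:
  "AE x in Pi\<^sub>M {..<n} (\<lambda>_. uniform_circle). inj_on x {..<n :: nat}"
proof -
  let ?N = "Pi\<^sub>M {..<n} (\<lambda>_. uniform_circle)"
  have "AE x in ?N. x i \<noteq> x j" if ij: "i < n" "j < n" "i \<noteq> j" for i j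
  proof -
    have R: "Measurable.pred (uniform_circle \<Otimes>\<^sub>M uniform_circle) (\<lambda>(p, q). p = q)"
      by measurable
    \<comment> \<open>With a trivial condition on the other coordinates the power is 1, and only the
      null diagonal remains.\<close>
    have "emeasure ?N {x \<in> space ?N. x i = x j \<and> (\<forall>k\<in>{..<n} - {i, j}. True)}
      = (\<integral>\<^sup>+ q. \<integral>\<^sup>+ p. (if p = q then emeasure uniform_circle {w \<in> sphere 0 1. True} ^ (n - 2) else 0)
          \<partial>uniform_circle \<partial>uniform_circle)"
      by (rule emeasure_PiM_two_special[OF ij R]) simp
    also have "\<dots> = (\<integral>\<^sup>+ q. \<integral>\<^sup>+ p. indicator {q} p \<partial>uniform_circle \<partial>uniform_circle)"
      using unif.emeasure_space_1 by (intro nn_integral_cong) (auto simp: indicator_def sphere_def)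
    also have "\<dots> = (\<integral>\<^sup>+ q. 0 \<partial>uniform_circle)"
    proof (rule nn_integral_cong)
      fix q assume "q \<in> space uniform_circle"
      then have "{q} \<in> sets uniform_circle"
        unfolding circle_borel_def sets_uniform_circle
        by (auto simp: sets_restrict_space image_iff intro!: bexI[of _ "{q}"])
      then show "(\<integral>\<^sup>+ p. indicator {q} p \<partial>uniform_circle) = 0"
        by (simp add: emeasure_uniform_circle_singleton)
    qed
    finally have "emeasure ?N {x \<in> space ?N. x i = x j} = 0" by simp
    moreover have "{x \<in> space ?N. x i = x j} \<in> sets ?N"
    proof -
      have "(\<lambda>x. x i) \<in> borel_measurable ?N" "(\<lambda>x. x j) \<in> borel_measurable ?N"
        using ij by (auto intro!: circle_borel_imp_borel measurable_component_singleton simp flip: sets_uniform_circle)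
      then show ?thesis by measurable
    qed
    ultimately show ?thesis by (intro AE_I[of _ _ "{x \<in> space ?N. x i = x j}"]) auto
  qed
  then have "AE x in ?N. \<forall>i\<in>{..<n}. \<forall>j\<in>{..<n}. i \<noteq> j \<longrightarrow> x i \<noteq> x j"
    by (intro AE_finite_allI) auto
  then show ?thesis by eventually_elim (auto simp: inj_on_def)
qed

text \<open>For \<open>m + 2\<close> independent uniform points: the probability that two designated
  ones are nearest to and farthest from \<open>z\<close>, with \<alpha> and \<beta> adding that they
  lie in their own cells.\<close>

definition compat_prob :: "bool \<Rightarrow> bool \<Rightarrow> nat \<Rightarrow> complex \<Rightarrow> ennreal" where
  "compat_prob \<alpha> \<beta> m z = (\<integral>\<^sup>+ q. \<integral>\<^sup>+ p. (if z \<bullet> q < z \<bullet> p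
     then emeasure uniform_circle {w \<in> sphere 0 1. compatible \<alpha> \<beta> z p q w} ^ m else 0)
     \<partial>uniform_circle \<partial>uniform_circle)"

lemma compatible_measurable [measurable]:
  "Measurable.pred (uniform_circle \<Otimes>\<^sub>M uniform_circle \<Otimes>\<^sub>M uniform_circle) (\<lambda>(p, q, w). compatible \<alpha> \<beta> z p q w)"
  unfolding compatible_def by measurable

lemma order_measurable [measurable]:
  "Measurable.pred (uniform_circle \<Otimes>\<^sub>M uniform_circle) (\<lambda>(p, q). z \<bullet> q < z \<bullet> p)"
  by measurable

lemma compatible_set_measurable [measurable]:
  "{w \<in> sphere 0 1. compatible \<alpha> \<beta> z p q w} \<in> sets circle_borel"
proof -
  have "Measurable.pred circle_borel (\<lambda>w. compatible \<alpha> \<beta> z p q w)"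
    unfolding compatible_def by measurable
  then show ?thesis by (simp add: pred_def)
qed

lemma emeasure_compatible_measurable [measurable]:
  "(\<lambda>(p, q). emeasure uniform_circle {w \<in> sphere 0 1. compatible \<alpha> \<beta> z p q w})
    \<in> borel_measurable (uniform_circle \<Otimes>\<^sub>M uniform_circle)"
proof -
  have "(\<lambda>x. emeasure uniform_circle {w \<in> sphere 0 1. compatible \<alpha> \<beta> z (fst x) (snd x) w})
    \<in> borel_measurable (uniform_circle \<Otimes>\<^sub>M uniform_circle)"
  proof (rule unif.measurable_emeasure)
    have "Measurable.pred ((uniform_circle \<Otimes>\<^sub>M uniform_circle) \<Otimes>\<^sub>M uniform_circle)
        (\<lambda>x. compatible \<alpha> \<beta> z (fst (fst x)) (snd (fst x)) (snd x))"
      unfolding compatible_def by measurable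
    then have "{x \<in> space ((uniform_circle \<Otimes>\<^sub>M uniform_circle) \<Otimes>\<^sub>M uniform_circle).
        compatible \<alpha> \<beta> z (fst (fst x)) (snd (fst x)) (snd x)}
      \<in> sets ((uniform_circle \<Otimes>\<^sub>M uniform_circle) \<Otimes>\<^sub>M uniform_circle)"
      by (simp add: pred_def)
    also have "{x \<in> space ((uniform_circle \<Otimes>\<^sub>M uniform_circle) \<Otimes>\<^sub>M uniform_circle).
        compatible \<alpha> \<beta> z (fst (fst x)) (snd (fst x)) (snd x)}
      = {x \<in> space ((uniform_circle \<Otimes>\<^sub>M uniform_circle) \<Otimes>\<^sub>M uniform_circle).
        snd x \<in> {w \<in> sphere 0 1. compatible \<alpha> \<beta> z (fst (fst x)) (snd (fst x)) w}}"
      by (auto simp: space_pair_measure)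
    finally show "{x \<in> space ((uniform_circle \<Otimes>\<^sub>M uniform_circle) \<Otimes>\<^sub>M uniform_circle).
        snd x \<in> {w \<in> sphere 0 1. compatible \<alpha> \<beta> z (fst (fst x)) (snd (fst x)) w}}
      \<in> sets ((uniform_circle \<Otimes>\<^sub>M uniform_circle) \<Otimes>\<^sub>M uniform_circle)" .
  qed auto
  then show ?thesis by (simp add: case_prod_unfold)
qed

lemma inner_rotate: "norm c = 1 \<Longrightarrow> (c * a) \<bullet> (c * b) = a \<bullet> (b :: complex)"
proof -
  assume "norm c = 1"
  then have "Re c * Re c + Im c * Im c = 1" using cmod_power2[of c] by (simp add: power2_eq_square)
  moreover have "(c * a) \<bullet> (c * b) = (Re c * Re c + Im c * Im c) * (a \<bullet> b)"
    by (simp add: inner_complex_def algebra_simps)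
  ultimately show ?thesis by simp
qed

text \<open>Inner products are unchanged when \<open>z\<close>, \<open>p\<close>, \<open>q\<close>
  and \<open>w\<close> are turned together, and each of the three uniform variables may be turned
  separately.\<close>

lemma compat_prob_rotate:
  assumes z: "norm z = 1" shows "compat_prob \<alpha> \<beta> m z = compat_prob \<alpha> \<beta> m 1"
proof -
  let ?U = uniform_circle
  let ?f = "\<lambda>z p q. if z \<bullet> q < z \<bullet> p
     then emeasure uniform_circle {w \<in> sphere 0 1. compatible \<alpha> \<beta> z p q w} ^ m else 0"
  have f [measurable]: "(\<lambda>(q, p). ?f z p q) \<in> borel_measurable (?U \<Otimes>\<^sub>M ?U)" for z
  proof -
    have "(\<lambda>(p, q). ?f z p q) \<in> borel_measurable (?U \<Otimes>\<^sub>M ?U)" by measurable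
    from measurable_compose[OF measurable_pair_swap' this] show ?thesis by (simp add: case_prod_unfold)
  qed
  have fz: "(\<lambda>p. ?f z p q) \<in> borel_measurable circle_borel" if "q \<in> sphere 0 1" for z q
    using measurable_compose[OF measurable_Pair1'[of q ?U ?U] f[of z]] that by simp
  have inv: "?f z (z * p) (z * q) = ?f 1 p q" if "p \<in> sphere 0 1" "q \<in> sphere 0 1" for p q
  proof -
    have *: "z \<bullet> (z * a) = 1 \<bullet> a" for a using inner_rotate[OF z, of 1 a] by simp
    have "emeasure ?U {w \<in> sphere 0 1. compatible \<alpha> \<beta> z (z * p) (z * q) w}
      = emeasure ?U {w \<in> sphere 0 1. compatible \<alpha> \<beta> 1 p q w}"
      by (rule emeasure_uniform_circle_rotate[OF compatible_set_measurable compatible_set_measurable z])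
        (auto simp: compatible_def * inner_rotate[OF z] norm_mult z)
    then show ?thesis unfolding * by simp
  qed
  have "compat_prob \<alpha> \<beta> m z = (\<integral>\<^sup>+ q. \<integral>\<^sup>+ p. ?f z p q \<partial>?U \<partial>?U)" unfolding compat_prob_def ..
  also have "\<dots> = (\<integral>\<^sup>+ q. \<integral>\<^sup>+ p. ?f z p (z * q) \<partial>?U \<partial>?U)"
    by (rule nn_integral_uniform_circle_rotate[OF _ z, symmetric]) measurable
  also have "\<dots> = (\<integral>\<^sup>+ q. \<integral>\<^sup>+ p. ?f z (z * p) (z * q) \<partial>?U \<partial>?U)"
    using z by (intro nn_integral_cong nn_integral_uniform_circle_rotate[OF fz z, symmetric]) (auto simp: norm_mult)
  also have "\<dots> = (\<integral>\<^sup>+ q. \<integral>\<^sup>+ p. ?f 1 p q \<partial>?U \<partial>?U)"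
    by (intro nn_integral_cong inv) auto
  finally show ?thesis unfolding compat_prob_def .
qed

lemma compat_prob_eq_double_integral:
  fixes g :: "real \<Rightarrow> real \<Rightarrow> real"
  assumes g: "\<And>x y. \<bar>x\<bar> + \<bar>y\<bar> < 1/2 \<Longrightarrow> emeasure lborel {s. \<bar>x\<bar> < \<bar>s\<bar> \<and> \<bar>s\<bar> < 1/2 - \<bar>y\<bar> \<and>
      (\<alpha> \<longrightarrow> min \<bar>s - x\<bar> (1 - \<bar>s - x\<bar>) < 1/2 - \<bar>x - y\<bar>)
      \<and> (\<beta> \<longrightarrow> \<bar>x - y\<bar> < min \<bar>s - y\<bar> (1 - \<bar>s - y\<bar>))} = ennreal (g x y)"
    and g0: "\<And>x y. \<bar>x\<bar> + \<bar>y\<bar> < 1/2 \<Longrightarrow> g x y \<ge> 0"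
  shows "compat_prob \<alpha> \<beta> m 1 = (\<integral>\<^sup>+ y. \<integral>\<^sup>+ x. (if \<bar>x\<bar> + \<bar>y\<bar> < 1/2 then ennreal (g x y ^ m) else 0) \<partial>lborel \<partial>lborel)"
proof -
  let ?U = uniform_circle
  let ?f = "\<lambda>p q. if 1 \<bullet> q < 1 \<bullet> p
     then emeasure uniform_circle {w \<in> sphere 0 1. compatible \<alpha> \<beta> 1 p q w} ^ m else 0"
  have f [measurable]: "(\<lambda>(q, p). ?f p q) \<in> borel_measurable (?U \<Otimes>\<^sub>M ?U)"
  proof -
    have "(\<lambda>(p, q). ?f p q) \<in> borel_measurable (?U \<Otimes>\<^sub>M ?U)" by measurable
    from measurable_compose[OF measurable_pair_swap' this] show ?thesis by (simp add: case_prod_unfold)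
  qed
  have fq: "(\<lambda>p. ?f p q) \<in> borel_measurable circle_borel" if "q \<in> sphere 0 1" for q
    using measurable_compose[OF measurable_Pair1'[of q ?U ?U] f] that by simp
  have h: "(\<lambda>q. \<integral>\<^sup>+ p. ?f p q \<partial>?U) \<in> borel_measurable circle_borel" by measurable
  have neg: "(\<lambda>q. (-1) * q) \<in> circle_borel \<rightarrow>\<^sub>M circle_borel"
    by (intro measurable_circle_borelI) (auto simp: norm_mult)
  have "compat_prob \<alpha> \<beta> m 1 = (\<integral>\<^sup>+ q. \<integral>\<^sup>+ p. ?f p q \<partial>?U \<partial>?U)" unfolding compat_prob_def ..
  \<comment> \<open>Passing to the antipode of \<open>q\<close> introduces the parameter
    \<open>y\<close>.\<close>
  also have "\<dots> = (\<integral>\<^sup>+ q. \<integral>\<^sup>+ p. ?f p ((-1) * q) \<partial>?U \<partial>?U)"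
    by (rule nn_integral_uniform_circle_rotate[OF h, symmetric]) simp
  also have "\<dots> = (\<integral>\<^sup>+ y. (\<integral>\<^sup>+ p. ?f p ((-1) * cis (2 * pi * y)) \<partial>?U) * indicator {-1/2..<1/2} y \<partial>lborel)"
    by (rule nn_integral_uniform_circle_sym) (rule measurable_compose[OF neg h])
  also have "\<dots> = (\<integral>\<^sup>+ y. \<integral>\<^sup>+ x. (if \<bar>x\<bar> + \<bar>y\<bar> < 1/2 then ennreal (g x y ^ m) else 0) \<partial>lborel \<partial>lborel)"
  proof (rule nn_integral_cong)
    fix y :: real
    show "(\<integral>\<^sup>+ p. ?f p ((-1) * cis (2 * pi * y)) \<partial>?U) * indicator {-1/2..<1/2} y
      = (\<integral>\<^sup>+ x. (if \<bar>x\<bar> + \<bar>y\<bar> < 1/2 then ennreal (g x y ^ m) else 0) \<partial>lborel)"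
    proof (cases "y \<in> {-1/2..<1/2}")
      case False
      then have *: "\<not> \<bar>x\<bar> + \<bar>y\<bar> < 1/2" for x by auto
      show ?thesis using False unfolding if_not_P[OF *] by simp
    next
      case y: True
    have "(\<integral>\<^sup>+ p. ?f p ((-1) * cis (2 * pi * y)) \<partial>?U)
      = (\<integral>\<^sup>+ x. ?f (cis (2 * pi * x)) ((-1) * cis (2 * pi * y)) * indicator {-1/2..<1/2} x \<partial>lborel)"
      by (rule nn_integral_uniform_circle_sym, rule fq) (auto simp: norm_mult)
    also have "\<dots> = (\<integral>\<^sup>+ x. (if \<bar>x\<bar> + \<bar>y\<bar> < 1/2 then ennreal (g x y ^ m) else 0) \<partial>lborel)"
    proof (rule nn_integral_cong)
      fix x :: real
      consider "x \<notin> {-1/2..<1/2}" | "x \<in> {-1/2..<1/2}" "\<not> \<bar>x\<bar> + \<bar>y\<bar> < 1/2" | "\<bar>x\<bar> + \<bar>y\<bar> < 1/2" "x \<in> {-1/2..<1/2}"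
        by auto
      then show "?f (cis (2 * pi * x)) ((-1) * cis (2 * pi * y)) * indicator {-1/2..<1/2} x
          = (if \<bar>x\<bar> + \<bar>y\<bar> < 1/2 then ennreal (g x y ^ m) else 0)"
      proof cases
        case 1
        then have "\<not> \<bar>x\<bar> + \<bar>y\<bar> < 1/2" by auto
        then show ?thesis using 1 by simp
      next
        case 2
        have "\<bar>x\<bar> \<le> 1/2" "\<bar>y\<bar> \<le> 1/2" using 2 y by auto
        then show ?thesis using inner_1_order_iff[of x y] 2 by simp
      next
        case 3
        have xy: "\<bar>x\<bar> \<le> 1/2" "\<bar>y\<bar> \<le> 1/2" using 3 by auto
        have "emeasure ?U {w \<in> sphere 0 1. compatible \<alpha> \<beta> 1 (cis (2 * pi * x)) (- cis (2 * pi * y)) w}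
          = emeasure lborel {t. -1/2 \<le> t \<and> t < 1/2 \<and>
             cis (2 * pi * t) \<in> {w \<in> sphere 0 1. compatible \<alpha> \<beta> 1 (cis (2 * pi * x)) (- cis (2 * pi * y)) w}}"
          by (rule emeasure_uniform_circle_sym) measurable
        also have "{t. -1/2 \<le> t \<and> t < 1/2 \<and>
             cis (2 * pi * t) \<in> {w \<in> sphere 0 1. compatible \<alpha> \<beta> 1 (cis (2 * pi * x)) (- cis (2 * pi * y)) w}}
          = {s. \<bar>x\<bar> < \<bar>s\<bar> \<and> \<bar>s\<bar> < 1/2 - \<bar>y\<bar> \<and>
              (\<alpha> \<longrightarrow> min \<bar>s - x\<bar> (1 - \<bar>s - x\<bar>) < 1/2 - \<bar>x - y\<bar>)
              \<and> (\<beta> \<longrightarrow> \<bar>x - y\<bar> < min \<bar>s - y\<bar> (1 - \<bar>s - y\<bar>))}" (is "?A = ?B")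
        proof (rule Collect_cong)
          fix s :: real
          show "(-1/2 \<le> s \<and> s < 1/2 \<and>
             cis (2 * pi * s) \<in> {w \<in> sphere 0 1. compatible \<alpha> \<beta> 1 (cis (2 * pi * x)) (- cis (2 * pi * y)) w})
            \<longleftrightarrow> (\<bar>x\<bar> < \<bar>s\<bar> \<and> \<bar>s\<bar> < 1/2 - \<bar>y\<bar> \<and>
              (\<alpha> \<longrightarrow> min \<bar>s - x\<bar> (1 - \<bar>s - x\<bar>) < 1/2 - \<bar>x - y\<bar>)
              \<and> (\<beta> \<longrightarrow> \<bar>x - y\<bar> < min \<bar>s - y\<bar> (1 - \<bar>s - y\<bar>)))"
          proof (cases "-1/2 \<le> s \<and> s < 1/2")
            case True
            then have "\<bar>s\<bar> \<le> 1/2" by auto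
            then show ?thesis using True compatible_iff[OF 3(1), of s \<alpha> \<beta>] by simp
          next
            case False
            \<comment> \<open>Outside the window the condition from \<open>q\<close> already fails,
              so \<open>s\<close> may range over all reals.\<close>
            then have "\<not> \<bar>s\<bar> < 1/2 - \<bar>y\<bar>" by auto
            then show ?thesis using False by blast
          qed
        qed
        also have "emeasure lborel \<dots> = ennreal (g x y)" using g[OF 3(1)] .
        finally show ?thesis
          using 3 inner_1_order_iff[OF xy] g0[OF 3(1)] by (simp add: ennreal_power)
      qed
    qed
    finally show ?thesis using y by simp
    qed
  qed
  finally show ?thesis .
qed

lemma compat_prob_0:
  assumes "norm z = 1"
  shows "compat_prob False False m z = ennreal (1 / ((real m + 1) * (real m + 2)))"
  unfolding compat_prob_rotate[OF assms] double_integral_0[symmetric]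
  by (rule compat_prob_eq_double_integral) (simp_all add: emeasure_arcs_0)

lemma compat_prob_A:
  assumes "norm z = 1"
  shows "compat_prob True False m z = ennreal ((5 + 3 * (1/3) ^ m) / (8 * (real m + 1) * (real m + 2)))"
  unfolding compat_prob_rotate[OF assms] double_integral_A[symmetric]
proof (rule compat_prob_eq_double_integral)
  fix x y :: real assume xy: "\<bar>x\<bar> + \<bar>y\<bar> < 1/2"
  show "1/2 - \<bar>x\<bar> - \<bar>y\<bar> + max 0 (1/2 - 2 * \<bar>x\<bar> - \<bar>x - y\<bar>) \<ge> 0" using xy by linarith
qed (simp only: emeasure_arcs_A simp_thms)

lemma compat_prob_B:
  assumes "norm z = 1"
  shows "compat_prob True True m z =
    ennreal ((3 + (1/3) ^ m * (2 * real m + 15) / 3) / (8 * (real m + 1) * (real m + 2)))"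
  unfolding compat_prob_rotate[OF assms] double_integral_B[symmetric]
proof (rule compat_prob_eq_double_integral)
  fix x y :: real assume xy: "\<bar>x\<bar> + \<bar>y\<bar> < 1/2"
  show "1/2 - \<bar>x\<bar> - \<bar>y\<bar> + max 0 (1/2 - \<bar>x\<bar> - \<bar>y\<bar> - 2 * \<bar>x - y\<bar>) \<ge> 0" using xy by linarith
qed (simp only: emeasure_arcs_B simp_thms)

text \<open>If \<open>z\<close> lies in the cell, no other label shares the point of
  \<open>i\<close> or of \<open>j\<close>. Each of these points is then strictly nearest to itself,
  and all that is left of lying in its own cell is that the other one is farthest.\<close>

lemma icell_compatible:
  assumes x: "\<And>k. k < n \<Longrightarrow> norm (x k) = 1" and ij: "i < n" "j < n" "i \<noteq> j"
  shows "(\<alpha> \<longrightarrow> x i \<in> icell n x i j) \<and> (\<beta> \<longrightarrow> x j \<in> icell n x j i) \<and> z \<in> icell n x i j \<longleftrightarrow>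
    z \<bullet> x j < z \<bullet> x i \<and> (\<forall>k\<in>{..<n} - {i, j}. compatible \<alpha> \<beta> z (x i) (x j) (x k))"
proof -
  have one: "x i \<bullet> x i = 1" "x j \<bullet> x j = 1" using x ij by (simp_all add: dot_square_norm)
  have zc: "z \<in> icell n x i j \<longleftrightarrow> z \<bullet> x j < z \<bullet> x i \<and>
      (\<forall>k\<in>{..<n} - {i, j}. z \<bullet> x k < z \<bullet> x i \<and> z \<bullet> x j < z \<bullet> x k)"
    unfolding icell_def using ij by auto
  have "x i \<in> icell n x i j \<longleftrightarrow> (\<forall>k\<in>{..<n} - {i, j}. x i \<bullet> x j < x i \<bullet> x k)"
    if "z \<in> icell n x i j"
  proof -
    have ne: "x k \<noteq> x i" if "k < n" "k \<noteq> i" for k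
      using \<open>z \<in> icell n x i j\<close> that unfolding icell_def by force
    have lt: "x i \<bullet> x k < x i \<bullet> x i" if "k < n" "k \<noteq> i" for k
      unfolding one using ne[OF that] x ij that by (intro inner_unit_less) auto
    show ?thesis unfolding icell_def using lt ij by auto
  qed
  moreover have "x j \<in> icell n x j i \<longleftrightarrow> (\<forall>k\<in>{..<n} - {i, j}. x j \<bullet> x i < x j \<bullet> x k)"
    if "z \<in> icell n x i j"
  proof -
    have ne: "x k \<noteq> x j" if "k < n" "k \<noteq> j" for k
      using \<open>z \<in> icell n x i j\<close> that unfolding icell_def by force
    have lt: "x j \<bullet> x k < x j \<bullet> x j" if "k < n" "k \<noteq> j" for k
      unfolding one using ne[OF that] x ij that by (intro inner_unit_less) auto
    show ?thesis unfolding icell_def using lt ij by auto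
  qed
  ultimately show ?thesis unfolding compatible_def using zc by blast
qed

abbreviation unif_points :: "nat \<Rightarrow> (nat \<Rightarrow> complex) measure" where
  "unif_points n \<equiv> Pi\<^sub>M {..<n} (\<lambda>_. uniform_circle)"

lemma unif_points_norm: "x \<in> space (unif_points n) \<Longrightarrow> k < n \<Longrightarrow> norm (x k) = 1"
  by (auto simp: space_PiM PiE_def Pi_def)

lemma emeasure_icell:
  assumes ij: "i < n" "j < n" "i \<noteq> j"
  shows "emeasure (unif_points n) {x \<in> space (unif_points n).
      (\<alpha> \<longrightarrow> x i \<in> icell n x i j) \<and> (\<beta> \<longrightarrow> x j \<in> icell n x j i) \<and> z \<in> icell n x i j}
    = compat_prob \<alpha> \<beta> (n - 2) z"
proof -
  have "{x \<in> space (unif_points n).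
      (\<alpha> \<longrightarrow> x i \<in> icell n x i j) \<and> (\<beta> \<longrightarrow> x j \<in> icell n x j i) \<and> z \<in> icell n x i j}
    = {x \<in> space (unif_points n). z \<bullet> x j < z \<bullet> x i \<and> (\<forall>k\<in>{..<n} - {i, j}. compatible \<alpha> \<beta> z (x i) (x j) (x k))}"
  proof (rule Collect_cong, rule conj_cong[OF refl])
    fix x assume x: "x \<in> space (unif_points n)"
    show "(\<alpha> \<longrightarrow> x i \<in> icell n x i j) \<and> (\<beta> \<longrightarrow> x j \<in> icell n x j i) \<and> z \<in> icell n x i j \<longleftrightarrow>
      z \<bullet> x j < z \<bullet> x i \<and> (\<forall>k\<in>{..<n} - {i, j}. compatible \<alpha> \<beta> z (x i) (x j) (x k))"
      by (rule icell_compatible[OF unif_points_norm[OF x] ij])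
  qed
  then show ?thesis
    unfolding compat_prob_def
    using emeasure_PiM_two_special[OF ij order_measurable[where z = z]
        compatible_measurable[where z = z and \<alpha> = \<alpha> and \<beta> = \<beta>]] by simp
qed

lemma unif_points_component [measurable]:
  "k < n \<Longrightarrow> (\<lambda>x. x k) \<in> borel_measurable (unif_points n)"
  by (rule circle_borel_imp_borel) (auto intro!: measurable_component_singleton simp flip: sets_uniform_circle)

text \<open>Both the vector and the configuration may vary, since below either one is held fixed,
  both are integrated, or the vector is itself one of the points.\<close>

lemma icell_measurable:
  assumes "i < n" "j < n" and [measurable]: "f \<in> borel_measurable M" "g \<in> M \<rightarrow>\<^sub>M unif_points n"
  shows "Measurable.pred M (\<lambda>x. f x \<in> icell n (g x) i j)"
proof -
  have g [measurable]: "(\<lambda>x. g x k) \<in> borel_measurable M" if "k < n" for k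
    using measurable_compose[OF assms(4) unif_points_component[OF that]] .
  have "Measurable.pred M (\<lambda>x. (\<forall>k\<in>{..<n} - {i}. f x \<bullet> g x k < f x \<bullet> g x i)
      \<and> (\<forall>k\<in>{..<n} - {j}. f x \<bullet> g x j < f x \<bullet> g x k))"
    using assms(1,2) by (intro pred_intros_logic pred_intros_finite) (auto intro!: borel_measurable_pred_less borel_measurable_inner g assms(3))
  also have "(\<lambda>x. (\<forall>k\<in>{..<n} - {i}. f x \<bullet> g x k < f x \<bullet> g x i)
      \<and> (\<forall>k\<in>{..<n} - {j}. f x \<bullet> g x j < f x \<bullet> g x k)) = (\<lambda>x. f x \<in> icell n (g x) i j)"
    unfolding icell_def by auto
  finally show ?thesis .
qed

text \<open>Tonelli: the expected measure of a random set is the integral over the circle of the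
  probability of covering a fixed point, here the constant \<open>c\<close>.\<close>

lemma has_bochner_integral_icell:
  assumes ij: "i < n" "j < n" and Q [measurable]: "Measurable.pred (unif_points n) Q" and "c \<ge> 0"
    and c: "\<And>z. norm z = 1 \<Longrightarrow> emeasure (unif_points n) {x \<in> space (unif_points n). Q x \<and> z \<in> icell n x i j} = ennreal c"
  shows "has_bochner_integral (unif_points n)
    (\<lambda>x. of_bool (Q x) * measure uniform_circle {w \<in> sphere 0 1. w \<in> icell n x i j}) c"
proof -
  let ?N = "unif_points n"
  interpret N: prob_space ?N by (intro prob_space_PiM prob_space_uniform_circle)
  interpret NU: pair_sigma_finite ?N uniform_circle ..
  have cell [measurable]: "Measurable.pred (?N \<Otimes>\<^sub>M uniform_circle) (\<lambda>y. snd y \<in> icell n (fst y) i j)"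
    by (intro icell_measurable ij circle_borel_imp_borel) (auto simp flip: sets_uniform_circle)
  have sets: "{w \<in> sphere 0 1. w \<in> icell n x i j} \<in> sets uniform_circle" if "x \<in> space ?N" for x
  proof -
    have "Measurable.pred uniform_circle (\<lambda>w. w \<in> icell n x i j)"
      using that by (intro icell_measurable ij circle_borel_imp_borel) auto
    then show ?thesis by (simp add: pred_def)
  qed
  have meas: "(\<lambda>x. emeasure uniform_circle {w \<in> sphere 0 1. w \<in> icell n x i j}) \<in> borel_measurable ?N"
  proof (rule unif.measurable_emeasure)
    have "{x \<in> space (?N \<Otimes>\<^sub>M uniform_circle). snd x \<in> icell n (fst x) i j} \<in> sets (?N \<Otimes>\<^sub>M uniform_circle)"
      using cell by (simp add: pred_def)
    also have "{x \<in> space (?N \<Otimes>\<^sub>M uniform_circle). snd x \<in> icell n (fst x) i j}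
      = {x \<in> space (?N \<Otimes>\<^sub>M uniform_circle). snd x \<in> {w \<in> sphere 0 1. w \<in> icell n (fst x) i j}}"
      by (auto simp: space_pair_measure)
    finally show "{x \<in> space (?N \<Otimes>\<^sub>M uniform_circle). snd x \<in> {w \<in> sphere 0 1. w \<in> icell n (fst x) i j}}
      \<in> sets (?N \<Otimes>\<^sub>M uniform_circle)" .
  qed auto
  have ind [measurable]: "(\<lambda>(x, w). indicator {y \<in> space (?N \<Otimes>\<^sub>M uniform_circle). Q (fst y) \<and> snd y \<in> icell n (fst y) i j} (x, w) :: ennreal)
      \<in> borel_measurable (?N \<Otimes>\<^sub>M uniform_circle)"
    by (simp add: case_prod_unfold)
  have "(\<integral>\<^sup>+ x. ennreal (of_bool (Q x) * measure uniform_circle {w \<in> sphere 0 1. w \<in> icell n x i j}) \<partial>?N)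
    = (\<integral>\<^sup>+ x. \<integral>\<^sup>+ w. indicator {y \<in> space (?N \<Otimes>\<^sub>M uniform_circle). Q (fst y) \<and> snd y \<in> icell n (fst y) i j} (x, w) \<partial>uniform_circle \<partial>?N)"
  proof (rule nn_integral_cong)
    fix x assume x: "x \<in> space ?N"
    let ?W = "{w \<in> sphere 0 1. w \<in> icell n x i j}"
    have "ennreal (of_bool (Q x) * measure uniform_circle ?W) = of_bool (Q x) * emeasure uniform_circle ?W"
      by (simp add: unif.emeasure_eq_measure)
    also have "\<dots> = (\<integral>\<^sup>+ w. of_bool (Q x) * indicator ?W w \<partial>uniform_circle)"
      using sets[OF x] by (subst nn_integral_cmult_indicator) auto
    also have "\<dots> = (\<integral>\<^sup>+ w. indicator {y \<in> space (?N \<Otimes>\<^sub>M uniform_circle). Q (fst y) \<and> snd y \<in> icell n (fst y) i j} (x, w) \<partial>uniform_circle)"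
      using x by (intro nn_integral_cong) (auto simp: indicator_def space_pair_measure)
    finally show "ennreal (of_bool (Q x) * measure uniform_circle ?W) = \<dots>" .
  qed
  also have "\<dots> = (\<integral>\<^sup>+ w. \<integral>\<^sup>+ x. indicator {y \<in> space (?N \<Otimes>\<^sub>M uniform_circle). Q (fst y) \<and> snd y \<in> icell n (fst y) i j} (x, w) \<partial>?N \<partial>uniform_circle)"
    by (rule NU.Fubini'[symmetric]) (rule ind)
  also have "\<dots> = (\<integral>\<^sup>+ w. ennreal c \<partial>uniform_circle)"
  proof (rule nn_integral_cong)
    fix w assume w: "w \<in> space uniform_circle"
    let ?E = "{x \<in> space ?N. Q x \<and> w \<in> icell n x i j}"
    have "Measurable.pred ?N (\<lambda>x. w \<in> icell n x i j)"
      by (intro icell_measurable ij) auto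
    then have E: "?E \<in> sets ?N" using Q by (simp add: pred_def)
    have "(\<integral>\<^sup>+ x. indicator {y \<in> space (?N \<Otimes>\<^sub>M uniform_circle). Q (fst y) \<and> snd y \<in> icell n (fst y) i j} (x, w) \<partial>?N)
      = (\<integral>\<^sup>+ x. indicator ?E x \<partial>?N)"
      using w by (intro nn_integral_cong) (auto simp: indicator_def space_pair_measure)
    then show "(\<integral>\<^sup>+ x. indicator {y \<in> space (?N \<Otimes>\<^sub>M uniform_circle). Q (fst y) \<and> snd y \<in> icell n (fst y) i j} (x, w) \<partial>?N) = ennreal c"
      using E c[of w] w by simp
  qed
  also have "\<dots> = ennreal c" using unif.emeasure_space_1 by simp
  finally have nn: "(\<integral>\<^sup>+ x. ennreal (of_bool (Q x) * measure uniform_circle {w \<in> sphere 0 1. w \<in> icell n x i j}) \<partial>?N) = ennreal c" .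
  have "(\<lambda>x. measure uniform_circle {w \<in> sphere 0 1. w \<in> icell n x i j}) \<in> borel_measurable ?N"
    unfolding measure_def using meas by measurable
  then have "(\<lambda>x. of_bool (Q x) * measure uniform_circle {w \<in> sphere 0 1. w \<in> icell n x i j}) \<in> borel_measurable ?N"
    unfolding of_bool_def by measurable
  then show ?thesis
    using nn \<open>c \<ge> 0\<close> by (intro has_bochner_integral_nn_integral) auto
qed

lemma icell_pred:
  assumes "i < n" "j < n" "k < n"
  shows "Measurable.pred (unif_points n) (\<lambda>x. x k \<in> icell n x i j)"
  using assms by (intro icell_measurable unif_points_component) auto

text \<open>Inclusion and exclusion: for indicators \<open>a\<close> and \<open>b\<close> of the two
  points, types 0, 1, 2 have indicators \<open>1 - a - b + a * b\<close>,
  \<open>a + b - 2 * a * b\<close> and \<open>a * b\<close>.\<close>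

lemma has_bochner_integral_type:
  assumes ij: "i < n" "j < n" "i \<noteq> j" and m: "m = n - 2"
  defines "c0 \<equiv> 1 / ((real m + 1) * (real m + 2))"
    and "cA \<equiv> (5 + 3 * (1/3) ^ m) / (8 * (real m + 1) * (real m + 2))"
    and "cB \<equiv> (3 + (1/3) ^ m * (2 * real m + 15) / 3) / (8 * (real m + 1) * (real m + 2))"
  defines "f \<equiv> \<lambda>k x. of_bool (of_bool (x i \<in> icell n x i j) + of_bool (x j \<in> icell n x j i) = (k :: nat)) *
    measure uniform_circle {w \<in> sphere 0 1. w \<in> icell n x i j}"
  shows "has_bochner_integral (unif_points n) (f 0) (c0 - cA - cA + cB)"
    "has_bochner_integral (unif_points n) (f 1) (cA + cA - 2 * cB)"
    "has_bochner_integral (unif_points n) (f 2) cB"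
proof -
  let ?N = "unif_points n"
  let ?v = "\<lambda>x. measure uniform_circle {w \<in> sphere 0 1. w \<in> icell n x i j}"
  let ?a = "\<lambda>x. x i \<in> icell n x i j" and ?b = "\<lambda>x. x j \<in> icell n x j i"
  have a [measurable]: "Measurable.pred ?N ?a" and b [measurable]: "Measurable.pred ?N ?b"
    using ij by (intro icell_pred; simp)+
  have nonneg: "c0 \<ge> 0" "cA \<ge> 0" "cB \<ge> 0" unfolding c0_def cA_def cB_def by simp_all
  have h0: "has_bochner_integral ?N (\<lambda>x. of_bool True * ?v x) c0"
  proof (rule has_bochner_integral_icell[OF ij(1,2) _ nonneg(1)])
    fix z :: complex assume "norm z = 1"
    then show "emeasure ?N {x \<in> space ?N. True \<and> z \<in> icell n x i j} = ennreal c0"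
      using emeasure_icell[OF ij, of False False z] by (simp add: compat_prob_0 c0_def m)
  qed simp
  have hA: "has_bochner_integral ?N (\<lambda>x. of_bool (?a x) * ?v x) cA"
  proof (rule has_bochner_integral_icell[OF ij(1,2) a nonneg(2)])
    fix z :: complex assume "norm z = 1"
    then show "emeasure ?N {x \<in> space ?N. ?a x \<and> z \<in> icell n x i j} = ennreal cA"
      using emeasure_icell[OF ij, of True False z] by (simp add: compat_prob_A cA_def m)
  qed
  have hb: "has_bochner_integral ?N (\<lambda>x. of_bool (?b x) * ?v x) cA"
  proof (rule has_bochner_integral_icell[OF ij(1,2) b nonneg(2)])
    fix z :: complex assume "norm z = 1"
    \<comment> \<open>The condition on \<open>j\<close> alone is the one on \<open>i\<close> alone
      with the labels exchanged and \<open>z\<close> replaced by its antipode.\<close>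
    moreover have "z \<in> icell n x i j \<longleftrightarrow> - z \<in> icell n x j i" for x
      unfolding icell_def by auto
    ultimately show "emeasure ?N {x \<in> space ?N. ?b x \<and> z \<in> icell n x i j} = ennreal cA"
      using emeasure_icell[OF ij(2,1) ij(3)[symmetric], of True False "- z"]
      by (simp add: compat_prob_A cA_def m)
  qed
  have hB: "has_bochner_integral ?N (\<lambda>x. of_bool (?a x \<and> ?b x) * ?v x) cB"
  proof (rule has_bochner_integral_icell[OF ij(1,2) _ nonneg(3)])
    fix z :: complex assume "norm z = 1"
    then show "emeasure ?N {x \<in> space ?N. (?a x \<and> ?b x) \<and> z \<in> icell n x i j} = ennreal cB"
      using emeasure_icell[OF ij, of True True z] by (simp add: compat_prob_B cB_def m conj_assoc)
  qed simp
  have "f 0 = (\<lambda>x. of_bool True * ?v x - of_bool (?a x) * ?v x - of_bool (?b x) * ?v x + of_bool (?a x \<and> ?b x) * ?v x)"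
    unfolding f_def by (auto simp: of_bool_def)
  then show "has_bochner_integral ?N (f 0) (c0 - cA - cA + cB)"
    by (simp only:) (intro has_bochner_integral_add has_bochner_integral_diff h0 hA hb hB)
  have "f 1 = (\<lambda>x. of_bool (?a x) * ?v x + of_bool (?b x) * ?v x - 2 * (of_bool (?a x \<and> ?b x) * ?v x))"
    unfolding f_def by (auto simp: of_bool_def)
  then show "has_bochner_integral ?N (f 1) (cA + cA - 2 * cB)"
    by (simp only:) (intro has_bochner_integral_add has_bochner_integral_diff has_bochner_integral_mult_right hA hb hB)
  have "f 2 = (\<lambda>x. of_bool (?a x \<and> ?b x) * ?v x)"
    unfolding f_def by (auto simp: of_bool_def)
  then show "has_bochner_integral ?N (f 2) cB" using hB by simp
qed

lemma inj_on_pred: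
  "Measurable.pred (unif_points n) (\<lambda>x. inj_on x {..<n})"
proof -
  have "Measurable.pred (unif_points n) (\<lambda>x. x i = x j)" if "i < n" "j < n" for i j
  proof -
    have "{x \<in> space (unif_points n). x i = x j} \<in> sets (unif_points n)"
      using unif_points_component[OF that(1)] unif_points_component[OF that(2)] by measurable
    then show ?thesis by (simp add: pred_def)
  qed
  then have "Measurable.pred (unif_points n) (\<lambda>x. \<forall>i\<in>{..<n}. \<forall>j\<in>{..<n}. x i = x j \<longrightarrow> i = j)"
    by (intro pred_intros_finite pred_intros_logic) auto
  then show ?thesis by (simp add: inj_on_def)
qed

lemma has_bochner_integral_total_length:
  assumes n: "n \<ge> 3"
    and c: "\<And>i j. i < n \<Longrightarrow> j < n \<Longrightarrow> i \<noteq> j \<Longrightarrow> has_bochner_integral (unif_points n)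
      (\<lambda>x. of_bool (of_bool (x i \<in> icell n x i j) + of_bool (x j \<in> icell n x j i) = k) *
        measure uniform_circle {w \<in> sphere 0 1. w \<in> icell n x i j}) c"
  shows "has_bochner_integral (unif_points n) (\<lambda>x. total_length k (ccw_points n x)) (real n * (real n - 1) * c)"
proof -
  let ?N = "unif_points n"
  define f where "f = (\<lambda>x. \<Sum>i<n. \<Sum>j\<in>{..<n} - {i}.
     of_bool (of_bool (x i \<in> icell n x i j) + of_bool (x j \<in> icell n x j i) = k) *
     measure uniform_circle {w \<in> sphere 0 1. w \<in> icell n x i j})"
  have "has_bochner_integral ?N f (\<Sum>i<n. \<Sum>j\<in>{..<n} - {i}. c)"
    unfolding f_def using c by (intro has_bochner_integral_sum) auto
  moreover have "(\<Sum>i<n. \<Sum>j\<in>{..<n} - {i}. c) = real n * (real n - 1) * c"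
    using n by (simp add: of_nat_diff)
  ultimately have f: "has_bochner_integral ?N f (real n * (real n - 1) * c)" by (simp only:)
  \<comment> \<open>This holds at every sample, coincident points included, and so gives
    measurability; the extra factor is 1 almost everywhere.\<close>
  have eq: "total_length k (ccw_points n x) = of_bool (inj_on x {..<n}) * f x" if x: "x \<in> space ?N" for x
  proof -
    have "icell n x i j \<in> sets borel" if "i < n" "j < n" for i j
    proof -
      have "Measurable.pred borel (\<lambda>w. w \<in> icell n x i j)"
        using that x by (intro icell_measurable) auto
      then show ?thesis by (simp add: pred_def)
    qed
    moreover have "x ` {..<n} \<subseteq> sphere 0 1" using unif_points_norm[OF x] by auto
    ultimately show ?thesis
      unfolding f_def using n by (simp add: total_length_ccw_points region_length_eq_measure)
  qed
  have [measurable]: "f \<in> borel_measurable ?N" using f by (auto elim: has_bochner_integral.cases)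
  have "(\<lambda>x. of_bool (inj_on x {..<n}) * f x) \<in> borel_measurable ?N"
    using inj_on_pred[of n] unfolding of_bool_def by measurable
  then have "(\<lambda>x. total_length k (ccw_points n x)) \<in> borel_measurable ?N"
    by (subst measurable_cong[OF eq])
  moreover have "AE x in ?N. total_length k (ccw_points n x) = f x"
    using AE_PiM_inj_on[of n] AE_space by eventually_elim (simp add: eq)
  ultimately show ?thesis using f by (subst has_bochner_integral_cong_AE[where g = f]) auto
qed

theorem theorem8:
  fixes M :: "'a measure" and X :: "nat \<Rightarrow> 'a \<Rightarrow> complex" and n :: nat
  assumes "prob_space M"
    and "n \<ge> 3"
    and "prob_space.indep_vars M (\<lambda>_. circle_borel) X {..<n}"
    and "\<And>i. i < n \<Longrightarrow> distr M circle_borel (X i) = uniform_circle"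
  defines "L \<equiv> \<lambda>k \<omega>. total_length k (ccw_points n (\<lambda>i. X i \<omega>))"
  shows "prob_space.expectation M (L 0) = (3 ^ (n - 1) + 2 * real n - 7) / (8 * 3 ^ (n - 1))
    \<and> prob_space.expectation M (L 1) = (3 ^ (n - 1) - real n - 1) / (2 * 3 ^ (n - 1))
    \<and> prob_space.expectation M (L 2) = (3 ^ n + 2 * real n + 11) / (8 * 3 ^ (n - 1))"
proof -
  interpret prob_space M by fact
  \<comment> \<open>Restriction to the index set makes the sample an element of the product space;
    the sorted list reads only these indices.\<close>
  define T where "T = (\<lambda>\<omega>. \<lambda>i\<in>{..<n}. X i \<omega>)"
  have rv: "random_variable circle_borel (X i)" if "i < n" for i
    using assms(3) that unfolding indep_vars_def2 by auto
  have T [measurable]: "T \<in> M \<rightarrow>\<^sub>M Pi\<^sub>M {..<n} (\<lambda>_. circle_borel)"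
    unfolding T_def using rv by (intro measurable_restrict) auto
  have "distr M (Pi\<^sub>M {..<n} (\<lambda>_. circle_borel)) T = Pi\<^sub>M {..<n} (\<lambda>i. distr M circle_borel (X i))"
    unfolding T_def using assms(2,3) rv
    by (subst indep_vars_iff_distr_eq_PiM'[symmetric]) (auto simp: lessThan_empty_iff)
  also have "\<dots> = unif_points n" using assms(4) by (intro PiM_cong) auto
  finally have distr: "distr M (Pi\<^sub>M {..<n} (\<lambda>_. circle_borel)) T = unif_points n" .
  have sets: "sets (Pi\<^sub>M {..<n} (\<lambda>_. circle_borel)) = sets (unif_points n)"
    by (intro sets_PiM_cong) auto
  have L: "L k \<omega> = total_length k (ccw_points n (T \<omega>))" for k \<omega>
  proof -
    have "map (\<lambda>i. X i \<omega>) [0..<n] = map (T \<omega>) [0..<n]" unfolding T_def by auto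
    then show ?thesis unfolding L_def ccw_points_def by (simp only:)
  qed
  have E: "expectation (L k) = v"
    if v: "has_bochner_integral (unif_points n) (\<lambda>x. total_length k (ccw_points n x)) v" for k v
  proof -
    have "(\<lambda>x. total_length k (ccw_points n x)) \<in> borel_measurable (Pi\<^sub>M {..<n} (\<lambda>_. circle_borel))"
      using v unfolding measurable_cong_sets[OF sets refl] by (auto elim: has_bochner_integral.cases)
    then have "(\<integral>x. total_length k (ccw_points n x) \<partial>unif_points n) = expectation (L k)"
      unfolding L distr[symmetric] by (intro integral_distr T)
    then show ?thesis using has_bochner_integral_integral_eq[OF v] by simp
  qed
  define m where "m = n - 2"
  have m: "real n = real m + 2" "n = m + 2" "n - 1 = Suc m" using assms(2) unfolding m_def by auto
  \<comment> \<open>This is the number \<open>n * (n - 1)\<close> of ordered pairs and also the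
    common denominator of the three probabilities, so it cancels.\<close>
  define K where "K = (real m + 1) * (real m + 2)"
  define q where "q = (3::real) ^ m"
  have pos: "K > 0" "q > 0" unfolding K_def q_def by (auto intro!: mult_pos_pos)
  have p: "(1/3::real) ^ m = 1 / q" "3 ^ (n - 1) = 3 * q" "3 ^ n = 9 * q"
    unfolding q_def m by (simp_all add: power_one_over)
  have nn: "real n * (real n - 1) = K" unfolding K_def m by (simp add: algebra_simps)
  define A where "A = (5 + 3 * (1/3) ^ m) / (8 * (real m + 1) * (real m + 2))"
  define B where "B = (3 + (1/3) ^ m * (2 * real m + 15) / 3) / (8 * (real m + 1) * (real m + 2))"
  have A: "A = (5 + 3 * (1 / q)) / (8 * K)" unfolding A_def K_def p by (simp only: mult.assoc)
  have B: "B = (3 + 1 / q * (2 * real m + 15) / 3) / (8 * K)" unfolding B_def K_def p by (simp only: mult.assoc)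
  have types: "expectation (L 0) = real n * (real n - 1) * (1 / ((real m + 1) * (real m + 2)) - A - A + B)"
    "expectation (L 1) = real n * (real n - 1) * (A + A - 2 * B)"
    "expectation (L 2) = real n * (real n - 1) * B"
    unfolding A_def B_def
    by (intro E has_bochner_integral_total_length[OF assms(2)] has_bochner_integral_type[OF _ _ _ m_def]; assumption)+
  show ?thesis
  proof (intro conjI)
    show "expectation (L 0) = (3 ^ (n - 1) + 2 * real n - 7) / (8 * 3 ^ (n - 1))"
      unfolding types nn unfolding K_def[symmetric] A B p unfolding m(1) using pos by (simp add: field_simps)
    show "expectation (L 1) = (3 ^ (n - 1) - real n - 1) / (2 * 3 ^ (n - 1))"
      unfolding types nn unfolding A B p unfolding m(1) using pos by (simp add: field_simps)
    show "expectation (L 2) = (3 ^ n + 2 * real n + 11) / (8 * 3 ^ (n - 1))"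
      unfolding types nn unfolding A B p unfolding m(1) using pos by (simp add: field_simps)
  qed
qed

end
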